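(* Let $A$ be a unital simple $C^*$-algebra with a unique normalized trace $\tau$. Then $\mathcal{F}(A)$ is a multiplicative subgroup of $\mathbb{R}^{\times}_{+}$. Furthermore, if $A$ is separable, then $\mathcal{F}(A)$ is countable.
   Context: A normalized trace is a tracial state. $\mathbb{R}^{\times}_+$ is the multiplicative group of positive real numbers. $Tr$ is the usual unnormalized trace on $M_n(\mathbb{C})$, so $\tau\otimes Tr(p)=\sum_i\tau(p_{ii})$ for $p=(p_{ij})\in M_n(A)$. For a unital simple $C^*$-algebra $A$ with a unique normalized trace $\tau$, put $$\mathcal{F}(A):=\{\tau\otimes Tr(p)\in\mathbb{R}^{\times}_+ \mid n\in\mathbb{N},\ p \text{ is a projection in } M_n(A) \text{ such that } pM_n(A)p\cong A\},$$ where $\cong$ denotes $*$-isomorphism of $C^*$-algebras. *)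

theory Defs
  imports "HOL-Analysis.Analysis" "HOL-Algebra.Group" "Jordan_Normal_Form.Matrix"
begin

text \<open>
  The real structure in the ancestor classes is tied to the complex one by \<open>scaleR_scaleC\<close>.
  Being nonzero is part of \<^class>\<open>real_normed_algebra_1\<close>.
\<close>

class unital_cstar_algebra = real_normed_algebra_1 + banach +
  fixes scaleC :: "complex \<Rightarrow> 'a \<Rightarrow> 'a"
    and star :: "'a \<Rightarrow> 'a"
  assumes scaleC_add_right: "scaleC c (x + y) = scaleC c x + scaleC c y"
    and scaleC_add_left: "scaleC (c + d) x = scaleC c x + scaleC d x"
    and scaleC_scaleC: "scaleC c (scaleC d x) = scaleC (c * d) x"
    and scaleR_scaleC: "scaleR r x = scaleC (complex_of_real r) x"
    and mult_scaleC_left: "scaleC c x * y = scaleC c (x * y)"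
    and mult_scaleC_right: "x * scaleC c y = scaleC c (x * y)"
    and norm_scaleC: "norm (scaleC c x) = cmod c * norm x"
    and star_add: "star (x + y) = star x + star y"
    and star_scaleC: "star (scaleC c x) = scaleC (cnj c) (star x)"
    and star_mult: "star (x * y) = star y * star x"
    and star_star: "star (star x) = x"
    and cstar_identity: "norm (star x * x) = (norm x)\<^sup>2"

instantiation complex :: unital_cstar_algebra
begin

definition scaleC_complex :: "complex \<Rightarrow> complex \<Rightarrow> complex"
  where "scaleC_complex = (*)"

definition star_complex :: "complex \<Rightarrow> complex"
  where "star_complex = cnj"

instance
  by standard
    (auto simp: scaleC_complex_def star_complex_def algebra_simps norm_mult scaleR_conv_of_real
      power2_eq_square)

end

definition closed_two_sided_ideal :: "'a::unital_cstar_algebra set \<Rightarrow> bool" where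
  "closed_two_sided_ideal I \<longleftrightarrow>
     closed I \<and> 0 \<in> I \<and>
     (\<forall>x\<in>I. \<forall>y\<in>I. x + y \<in> I) \<and>
     (\<forall>c. \<forall>x\<in>I. scaleC c x \<in> I) \<and>
     (\<forall>a. \<forall>x\<in>I. a * x \<in> I \<and> x * a \<in> I)"

definition simple_cstar :: "'a::unital_cstar_algebra itself \<Rightarrow> bool" where
  "simple_cstar _ \<longleftrightarrow>
     (\<forall>I :: 'a set. closed_two_sided_ideal I \<longrightarrow> I = {0} \<or> I = UNIV)"

text \<open>
  The order on \<^typ>\<open>complex\<close> is that of \<^theory>\<open>HOL-Library.Complex_Order\<close>: \<open>0 \<le> z\<close> says that
  \<open>z\<close> is real and nonnegative, and \<open>0 < z\<close> that it is real and positive.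
\<close>

definition tracial_state :: "('a::unital_cstar_algebra \<Rightarrow> complex) \<Rightarrow> bool" where
  "tracial_state \<tau> \<longleftrightarrow>
     (\<forall>x y. \<tau> (x + y) = \<tau> x + \<tau> y) \<and>
     (\<forall>c x. \<tau> (scaleC c x) = c * \<tau> x) \<and>
     (\<forall>x. 0 \<le> \<tau> (star x * x)) \<and>
     \<tau> 1 = 1 \<and>
     (\<forall>x y. \<tau> (x * y) = \<tau> (y * x))"

definition mat_star :: "'a::unital_cstar_algebra mat \<Rightarrow> 'a mat" where
  "mat_star x = Matrix.mat (dim_col x) (dim_row x) (\<lambda>(i, j). star (x $$ (j, i)))"

text \<open>\<open>smult_mat\<close> from the library only scales by elements of \<open>A\<close> itself.\<close>

definition mat_scaleC :: "complex \<Rightarrow> 'a::unital_cstar_algebra mat \<Rightarrow> 'a mat" where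
  "mat_scaleC c x = map_mat (scaleC c) x"

definition mat_projection :: "nat \<Rightarrow> 'a::unital_cstar_algebra mat \<Rightarrow> bool" where
  "mat_projection n p \<longleftrightarrow> p \<in> carrier_mat n n \<and> p * p = p \<and> mat_star p = p"

definition corner :: "nat \<Rightarrow> 'a::unital_cstar_algebra mat \<Rightarrow> 'a mat set" where
  "corner n p = {p * x * p | x. x \<in> carrier_mat n n}"

text \<open>
  \<open>B\<close> is meant to be a \<open>*\<close>-subalgebra of some matrix algebra over \<open>A\<close>. A bijective
  \<open>*\<close>-homomorphism of \<open>C*\<close>-algebras is automatically isometric, and it maps \<open>1\<close> to the unit
  of \<open>B\<close>, so neither a norm on \<open>B\<close> nor a condition on units is needed.
\<close>

definition star_isomorphism_onto :: "('a::unital_cstar_algebra \<Rightarrow> 'a mat) \<Rightarrow> 'a mat set \<Rightarrow> bool" where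
  "star_isomorphism_onto \<phi> B \<longleftrightarrow>
     bij_betw \<phi> UNIV B \<and>
     (\<forall>x y. \<phi> (x + y) = \<phi> x + \<phi> y) \<and>
     (\<forall>c x. \<phi> (scaleC c x) = mat_scaleC c (\<phi> x)) \<and>
     (\<forall>x y. \<phi> (x * y) = \<phi> x * \<phi> y) \<and>
     (\<forall>x. \<phi> (star x) = mat_star (\<phi> x))"

definition mat_trace :: "('a::unital_cstar_algebra \<Rightarrow> complex) \<Rightarrow> nat \<Rightarrow> 'a mat \<Rightarrow> complex" where
  "mat_trace \<tau> n p = (\<Sum>i<n. \<tau> (p $$ (i, i)))"

text \<open>
  The values are collected as complex numbers, so that their being positive reals is not imposed
  here but is part of the claim that they form a subgroup of \<open>pos_reals\<close>.
\<close>

definition fundamental_group :: "('a::unital_cstar_algebra \<Rightarrow> complex) \<Rightarrow> complex set" where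
  "fundamental_group \<tau> =
     {mat_trace \<tau> n p | n p. mat_projection n p \<and> (\<exists>\<phi>. star_isomorphism_onto \<phi> (corner n p))}"

definition pos_reals :: "complex monoid" where
  "pos_reals = \<lparr>carrier = {z. 0 < z}, monoid.mult = (*), one = 1\<rparr>"

end

(*
  Multiplicativity: for an isomorphism phi from A onto p M_n(A) p, uniqueness of the trace gives
  (tau (x) Tr)(phi(a)) = (tau (x) Tr)(p) tau(a), so applying phi entrywise to q in M_m(A) yields a
  projection in M_mn(A) whose trace is the product of the traces and whose corner is again A.
  Inverses: simplicity makes p full, which yields a column v over p M_n(A) p with v* v = 1; the
  projection v v* is the entrywise image of some q in M_m(A), and q has trace 1 / Tr(p).
  Normalising v needs d* d >= 0, which is obtained from the faithful trace and the binomial series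
  of the square root.  Countability: entrywise close projections are similar, hence have equal trace.
*)

theory Submission
  imports Defs
begin

section \<open>Square roots and the faithful trace\<close>

text \<open>Inverses follow the pattern of Morita equivalence. An isomorphism from A onto the corner
  of \<open>p\<close> makes the right module p A^n an invertible A-A-bimodule; products in F(A)
  correspond to tensor products, and the inverse to the conjugate bimodule. In matrices: for an
  isometric column \<open>v\<close>, sending \<open>a\<close> to \<open>v a star(v)\<close>
  identifies A with the corner of \<open>v star(v)\<close>. As \<open>v\<close> is a column over
  \<open>p\<close>, this corner lies under diag(p, ..., p), the unit of the image of the entrywise
  map, and can therefore be pulled back to M_m(A). The shape of the proof comes from the fact that
  matrices carry no norm here: functional calculus takes place in A alone, applied to A-valued inner
  products of vectors, and estimates on matrices are made entry by entry. In A the analytic tools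
  are the Neumann series and the binomial series. The latter is needed on the boundary of its disc,
  at elements with \<open>norm (1 - a) = 1\<close>, so the exact size of its coefficients
  matters.\<close>

lemma scaleC_one [simp]: "scaleC 1 x = (x::'a::unital_cstar_algebra)"
  by (metis of_real_1 scaleR_scaleC scaleR_one)

lemma star_zero [simp]: "star (0::'a::unital_cstar_algebra) = 0"
  by (metis add_cancel_right_right star_add)

lemma star_minus: "star (- x) = - star (x::'a::unital_cstar_algebra)"
  by (metis add_eq_0_iff star_add star_zero)

lemma star_diff: "star (x - y) = star x - star (y::'a::unital_cstar_algebra)"
  by (metis diff_conv_add_uminus star_add star_minus)

lemma star_scaleR: "star (r *\<^sub>R x) = r *\<^sub>R star (x::'a::unital_cstar_algebra)"
  by (simp add: scaleR_scaleC star_scaleC)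

lemma star_one [simp]: "star (1::'a::unital_cstar_algebra) = 1"
  by (metis mult_1 mult_1_right star_mult star_star)

lemma star_sum: "star (sum f A) = (\<Sum>i\<in>A. star (f i :: 'a::unital_cstar_algebra))"
  by (induction A rule: infinite_finite_induct) (auto simp: star_add)

lemma star_sum_list: "star (sum_list xs) = sum_list (map star (xs :: 'a::unital_cstar_algebra list))"
  by (induction xs) (auto simp: star_add)

lemma star_power: "star (x ^ n) = star (x::'a::unital_cstar_algebra) ^ n"
  by (induction n) (auto simp: star_mult power_commutes)

lemma norm_le_norm_star: "norm (x::'a::unital_cstar_algebra) \<le> norm (star x)"
proof (cases "x = 0")
  case False
  have "norm x * norm x \<le> norm (star x) * norm x"
    using cstar_identity[of x] norm_mult_ineq[of "star x" x] by (simp add: power2_eq_square)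
  then show ?thesis using False by simp
qed simp

lemma norm_star [simp]: "norm (star x) = norm (x::'a::unital_cstar_algebra)"
  by (metis norm_le_norm_star order_antisym star_star)

lemma bounded_linear_star: "bounded_linear (star :: 'a::unital_cstar_algebra \<Rightarrow> 'a)"
  by (rule bounded_linear_intro[where K = 1]) (auto simp: star_add star_scaleR)

lemma norm_selfadjoint_square:
  "star x = (x::'a::unital_cstar_algebra) \<Longrightarrow> norm (x * x) = (norm x)\<^sup>2"
  by (metis cstar_identity)

lemma scaleC_zero_left [simp]: "scaleC 0 x = (0::'a::unital_cstar_algebra)"
  by (metis scaleC_add_left add_cancel_right_right)

lemma scaleC_minus_left: "scaleC (- c) x = - scaleC c (x::'a::unital_cstar_algebra)"
  by (metis add.right_inverse add_eq_0_iff scaleC_add_left scaleC_zero_left)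

lemma scaleC_diff_right: "scaleC c (x - y) = scaleC c x - scaleC c (y::'a::unital_cstar_algebra)"
  by (metis add_diff_cancel_right' diff_add_cancel scaleC_add_right)

section \<open>Invertibility near 1 and ideals of a simple algebra\<close>

lemma near_one_invertible:
  fixes x :: "'a::{real_normed_algebra_1,banach}"
  assumes "norm (1 - x) < 1"
  shows "\<exists>y. x * y = 1 \<and> y * x = 1"
proof -
  define b where "b = 1 - x"
  have nb: "norm b < 1" using assms b_def by simp
  have s: "summable (\<lambda>n. b ^ n)"
    using nb by (rule complete_algebra_summable_geometric)
  define y where "y = (\<Sum>n. b ^ n)"
  have "(\<lambda>n. b ^ Suc n) sums (y - 1)"
    using summable_sums[OF s] unfolding sums_Suc_iff y_def by simp
  moreover have "(\<lambda>n. b ^ Suc n) sums (b * y)"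
    unfolding y_def power_Suc by (intro sums_mult summable_sums s)
  moreover have "(\<lambda>n. b ^ Suc n) sums (y * b)"
    unfolding y_def power_Suc2 by (intro sums_mult2 summable_sums s)
  ultimately have "b * y = y - 1" "y * b = y - 1" using sums_unique2 by blast+
  then have "x * y = 1 \<and> y * x = 1" by (auto simp: b_def algebra_simps)
  then show ?thesis by blast
qed

text \<open>The closure of \<open>J\<close> is a closed ideal, hence everything, so \<open>J\<close>
  has an element at distance less than 1 from \<open>1\<close>. Such an element is invertible, and
  multiplying by its inverse gives \<open>1\<close>. This covers ideals such as sets of finite sums
  of inner products, whose closedness is not evident.\<close>

lemma simple_ideal_contains_one:
  fixes J :: "'a::unital_cstar_algebra set"
  assumes simple: "simple_cstar TYPE('a)"
    and add: "\<And>x y. x \<in> J \<Longrightarrow> y \<in> J \<Longrightarrow> x + y \<in> J"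
    and ml: "\<And>a x. x \<in> J \<Longrightarrow> a * x \<in> J"
    and mr: "\<And>a x. x \<in> J \<Longrightarrow> x * a \<in> J"
    and x: "x \<in> J" "x \<noteq> 0"
  shows "1 \<in> J"
proof -
  have sc: "scaleC c u \<in> J" if "u \<in> J" for c u
    using ml[OF that, of "scaleC c 1"] by (simp add: mult_scaleC_left)
  have lim: "f u \<in> closure J" if "u \<in> closure J" "bounded_linear f" "\<And>v. v \<in> J \<Longrightarrow> f v \<in> J"
    for f :: "'a \<Rightarrow> 'a" and u
  proof -
    have "f ` closure J \<subseteq> closure J"
      using that(3) closure_subset[of J]
      by (intro image_closure_subset linear_continuous_on that(2) closed_closure) auto
    then show ?thesis using that(1) by blast
  qed
  have bl: "bounded_linear (scaleC c :: 'a \<Rightarrow> 'a)" for c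
    by (rule bounded_linear_intro[where K = "cmod c"])
      (auto simp: scaleC_add_right norm_scaleC scaleR_scaleC scaleC_scaleC mult.commute)
  have cadd: "u + v \<in> closure J" if u: "u \<in> closure J" and v: "v \<in> closure J" for u v
  proof -
    obtain f g where "\<And>n::nat. f n \<in> J" "f \<longlonglongrightarrow> u" "\<And>n::nat. g n \<in> J" "g \<longlonglongrightarrow> v"
      using u v unfolding closure_sequential by blast
    then show ?thesis unfolding closure_sequential
      by (intro exI[of _ "\<lambda>n. f n + g n"]) (auto intro: add tendsto_add)
  qed
  have "0 \<in> J" using ml[OF x(1), of 0] by simp
  then have "0 \<in> closure J" using closure_subset[of J] by blast
  moreover have "scaleC c u \<in> closure J" "a * u \<in> closure J" "u * a \<in> closure J"
    if "u \<in> closure J" for c a u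
    using lim[OF that bl[of c] sc] lim[OF that bounded_linear_mult_right[of a] ml]
      lim[OF that bounded_linear_mult_left[of a] mr] by simp_all
  ultimately have "closed_two_sided_ideal (closure J)"
    unfolding closed_two_sided_ideal_def using cadd by simp
  then have "closure J = UNIV"
    using simple x closure_subset[of J] unfolding simple_cstar_def by blast
  then have "\<forall>\<epsilon>>0. \<exists>u\<in>J. dist u 1 < \<epsilon>"
    using closure_approachable[of "1::'a" J] by simp
  then have "\<exists>u\<in>J. dist u 1 < 1" by (rule allE[of _ 1]) simp
  then obtain u where "u \<in> J" "dist u 1 < 1" by blast
  then have u: "u \<in> J" "norm (1 - u) < 1" by (simp_all add: dist_norm norm_minus_commute)
  then obtain v where "u * v = 1" using near_one_invertible by blast
  then show ?thesis using mr[OF u(1)] by metis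
qed

section \<open>Faithfulness of the trace\<close>

lemma tracial_state_diff: "tracial_state \<tau> \<Longrightarrow> \<tau> (x - y) = \<tau> x - \<tau> y"
  unfolding tracial_state_def by (metis add_diff_cancel_right' diff_add_cancel)

lemma tracial_state_0: "tracial_state \<tau> \<Longrightarrow> \<tau> 0 = 0"
  using tracial_state_diff[of \<tau> 0 0] by simp

lemma tracial_state_sum: "tracial_state \<tau> \<Longrightarrow> \<tau> (sum f A) = (\<Sum>i\<in>A. \<tau> (f i))"
  by (induction A rule: infinite_finite_induct) (auto simp: tracial_state_0 tracial_state_def)

text \<open>Comparing \<open>w + c x\<close> for \<open>c = \<plusminus>t\<close> and \<open>c = \<plusminus>\<i>t\<close> replaces the Cauchy-Schwarz inequality.\<close>

lemma tracial_state_null_orthogonal: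
  assumes tr: "tracial_state \<tau>" and 0: "\<tau> (star x * x) = 0"
  shows "\<tau> (y * x) = 0"
proof -
  define w where "w = star y"
  define \<alpha> \<beta> R where "\<alpha> = \<tau> (star w * x)" and "\<beta> = \<tau> (star x * w)" and "R = \<tau> (star w * w)"
  have pos: "0 \<le> R + c * \<alpha> + cnj c * \<beta>" for c
  proof -
    have "star (w + scaleC c x) * (w + scaleC c x) = star w * w + scaleC c (star w * x)
       + scaleC (cnj c) (star x * w) + scaleC (cnj c * c) (star x * x)"
      by (simp add: star_add star_scaleC distrib_left distrib_right mult_scaleC_left
          mult_scaleC_right scaleC_scaleC scaleC_add_right add_ac mult_ac)
    then have "\<tau> (star (w + scaleC c x) * (w + scaleC c x)) = R + c * \<alpha> + cnj c * \<beta>"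
      using tr 0 by (simp add: tracial_state_def \<alpha>_def \<beta>_def R_def)
    then show ?thesis using tr unfolding tracial_state_def by metis
  qed
  have lin: "z = 0" if "\<And>t. 0 \<le> R + of_real t * z" for z
  proof -
    have i: "Im z = 0"
      using that[of 0] that[of 1] by (simp add: less_eq_complex_def)
    have r: "0 \<le> Re R + t * Re z" for t
      using that[of t] by (simp add: less_eq_complex_def)
    have "Re z = 0"
    proof (rule ccontr)
      assume n: "Re z \<noteq> 0"
      \<comment> \<open>This multiple makes the right-hand side equal to -1.\<close>
      have "0 \<le> Re R + (- (Re R + 1) / Re z) * Re z" by (rule r)
      then show False using n by simp
    qed
    then show ?thesis using i by (simp add: complex_eq_iff)
  qed
  have "\<alpha> + \<beta> = 0"
  proof (rule lin)
    show "0 \<le> R + of_real t * (\<alpha> + \<beta>)" for t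
      using pos[of "of_real t"] by (simp add: algebra_simps)
  qed
  moreover have "\<i> * (\<alpha> - \<beta>) = 0"
  proof (rule lin)
    show "0 \<le> R + of_real t * (\<i> * (\<alpha> - \<beta>))" for t
      using pos[of "\<i> * of_real t"] by (simp add: algebra_simps)
  qed
  ultimately have "\<alpha> = 0" by simp
  then show ?thesis by (simp add: \<alpha>_def w_def star_star)
qed

text \<open>The trace property makes the kernel \<open>J\<close> a two-sided ideal; it contains
  \<open>x\<close> by the preceding lemma, so simplicity would force
  \<open>\<tau> 1 = 0\<close>.\<close>

lemma tracial_state_faithful:
  fixes \<tau> :: "'a::unital_cstar_algebra \<Rightarrow> complex"
  assumes simple: "simple_cstar TYPE('a)" and tr: "tracial_state \<tau>" and 0: "\<tau> (star x * x) = 0"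
  shows "x = 0"
proof (rule ccontr)
  assume x: "x \<noteq> 0"
  define J where "J = {x. \<forall>y. \<tau> (y * x) = 0}"
  have comm: "\<tau> (a * b) = \<tau> (b * a)" for a b using tr by (simp add: tracial_state_def)
  have "1 \<in> J"
  proof (rule simple_ideal_contains_one[OF simple _ _ _ _ x])
    show "x \<in> J" unfolding J_def using tracial_state_null_orthogonal[OF tr 0] by simp
    show "u + v \<in> J" if "u \<in> J" "v \<in> J" for u v
      using that tr by (simp add: J_def distrib_left tracial_state_def)
    show "a * u \<in> J" if "u \<in> J" for a u
      using that by (simp add: J_def mult.assoc[symmetric])
    show "u * a \<in> J" if "u \<in> J" for a u
    proof -
      have "\<tau> (y * (u * a)) = \<tau> ((a * y) * u)" for y
        using comm[of "y * u" a] by (simp add: mult.assoc)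
      then show ?thesis using that by (simp add: J_def)
    qed
  qed
  then have "\<tau> (1 * 1) = 0" unfolding J_def by blast
  then show False using tr by (simp add: tracial_state_def)
qed

section \<open>The binomial series of the square root, and positive elements\<close>

text \<open>The coefficients of the power series of \<open>sqrt (1 - x)\<close>, that is
  \<open>(- 1) ^ n * ((1 / 2) gchoose n)\<close>; the Pochhammer form makes their signs
  visible.\<close>

definition sqrt_coeff :: "nat \<Rightarrow> real" where
  "sqrt_coeff n = pochhammer (- 1 / 2) n / fact n"

lemma sqrt_coeff_0 [simp]: "sqrt_coeff 0 = 1" by (simp add: sqrt_coeff_def)

lemma sqrt_coeff_Suc_nonpos: "sqrt_coeff (Suc n) \<le> 0"
  using pochhammer_pos[of "1 / 2 :: real" n]
  by (simp add: sqrt_coeff_def pochhammer_rec divide_simps)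

text \<open>Partial sums of coefficients are the coefficients of the quotient by
  \<open>1 - x\<close>, here of the series of \<open>1 - x\<close> to the power -1/2, which are
  nonnegative.\<close>

lemma sum_sqrt_coeff: "(\<Sum>k\<le>n. sqrt_coeff k) = pochhammer (1 / 2) n / fact n"
proof (induction n)
  case (Suc n)
  have "pochhammer (- 1 / 2 :: real) (Suc n) = (- 1 / 2) * pochhammer (1 / 2) n"
    by (simp add: pochhammer_rec)
  then have "(\<Sum>k\<le>Suc n. sqrt_coeff k)
      = pochhammer (1 / 2) n / fact n + (- 1 / 2) * pochhammer (1 / 2) n / fact (Suc n)"
    using Suc by (simp add: sqrt_coeff_def)
  also have "\<dots> = pochhammer (1 / 2) (Suc n) / fact (Suc n)"
    by (simp add: pochhammer_Suc divide_simps) (simp add: algebra_simps)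
  finally show ?case .
qed simp

text \<open>All coefficients but the first are nonpositive and the partial sums are nonnegative, so
  the later absolute values cannot outweigh the leading \<open>1\<close>. The bound serves twice:
  for convergence when \<open>norm b = 1\<close>, and for \<open>norm (1 - k) \<le> 1\<close> at the
  root \<open>k\<close>.\<close>

lemma sum_norm_sqrt_coeff: "(\<Sum>k<n. \<bar>sqrt_coeff (Suc k)\<bar>) \<le> 1"
proof -
  have "0 \<le> (\<Sum>k\<le>n. sqrt_coeff k)"
    unfolding sum_sqrt_coeff by (simp add: pochhammer_nonneg)
  also have "\<dots> = 1 + (\<Sum>k<n. sqrt_coeff (Suc k))"
    by (simp add: sum.atMost_shift)
  also have "\<dots> = 1 - (\<Sum>k<n. \<bar>sqrt_coeff (Suc k)\<bar>)"
    using sqrt_coeff_Suc_nonpos by (simp add: sum_negf[symmetric])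
  finally show ?thesis by simp
qed

lemma summable_sqrt_coeff: "summable (\<lambda>k. \<bar>sqrt_coeff (Suc k)\<bar>)"
  by (rule bounded_imp_summable[of _ 1])
    (simp_all only: sum_norm_sqrt_coeff abs_ge_zero flip: lessThan_Suc_atMost)

text \<open>Vandermonde's identity with 1/2 + 1/2 = 1: the formal series squares to
  \<open>1 - x\<close>.\<close>

lemma sqrt_coeff_convolution:
  "(\<Sum>k\<le>n. sqrt_coeff k * sqrt_coeff (n - k)) = (if n = 0 then 1 else if n = 1 then -1 else 0)"
proof -
  have f: "sqrt_coeff k = (- 1) ^ k * ((1 / 2) gchoose k)" for k
    by (simp add: sqrt_coeff_def gbinomial_pochhammer)
  have "(\<Sum>k\<le>n. sqrt_coeff k * sqrt_coeff (n - k))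
      = (\<Sum>k\<le>n. (- 1) ^ n * (((1 / 2) gchoose k) * ((1 / 2) gchoose (n - k))))"
  proof (intro sum.cong refl)
    fix k assume "k \<in> {..n}"
    then have "(- 1 :: real) ^ n = (- 1) ^ k * (- 1) ^ (n - k)" by (simp flip: power_add)
    then show "sqrt_coeff k * sqrt_coeff (n - k)
        = (- 1) ^ n * (((1 / 2) gchoose k) * ((1 / 2) gchoose (n - k)))"
      by (simp add: f)
  qed
  also have "\<dots> = (- 1) ^ n * ((1 / 2 + 1 / 2) gchoose n)"
    by (simp only: sum_distrib_left[symmetric] gbinomial_Vandermonde[unfolded atLeast0AtMost])
  also have "\<dots> = (- 1) ^ n * real (1 choose n)"
    by (simp add: binomial_gbinomial)
  also have "\<dots> = (if n = 0 then 1 else if n = 1 then -1 else 0)"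
    by (cases n) (auto simp: binomial_eq_0)
  finally show ?thesis .
qed

text \<open>The bound on \<open>1 - k\<close> allows a second application to the root itself, and
  the commutation clause holds because \<open>k\<close> is a limit of polynomials in
  \<open>a\<close>. The boundary case \<open>norm (1 - a) = 1\<close> is the one met when
  \<open>a\<close> is not invertible.\<close>

lemma selfadjoint_sqrt:
  fixes a :: "'a::unital_cstar_algebra"
  assumes sa: "star a = a" and na: "norm (1 - a) \<le> 1"
  shows "\<exists>k. star k = k \<and> k * k = a \<and> norm (1 - k) \<le> 1 \<and> (\<forall>c. c * a = a * c \<longrightarrow> c * k = k * c)"
proof -
  define b where "b = 1 - a"
  define f where "f n = sqrt_coeff n *\<^sub>R b ^ n" for n
  have nb: "norm (b ^ n) \<le> 1" for n
    using norm_power_ineq[of b n] power_le_one[of "norm b" n] na by (simp add: b_def)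
  have nf: "norm (f n) \<le> \<bar>sqrt_coeff n\<bar>" for n
    using mult_left_mono[OF nb[of n], of "\<bar>sqrt_coeff n\<bar>"] by (simp add: f_def)
  have sS: "summable (\<lambda>n. norm (f (Suc n)))"
    by (rule summable_comparison_test[OF _ summable_sqrt_coeff]) (use nf in auto)
  then have sn: "summable (\<lambda>n. norm (f n))"
    using summable_Suc_iff[of "\<lambda>n. norm (f n)"] by blast
  then have s: "summable f" by (rule summable_norm_cancel)
  define k where "k = suminf f"
  have "k * k = (\<Sum>n. \<Sum>i\<le>n. f i * f (n - i))"
    unfolding k_def by (rule Cauchy_product[OF sn sn])
  also have "(\<lambda>n. \<Sum>i\<le>n. f i * f (n - i)) = (\<lambda>n. (if n = 0 then 1 else if n = 1 then -1 else 0) *\<^sub>R b ^ n)"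
  proof
    fix n
    have "f i * f (n - i) = (sqrt_coeff i * sqrt_coeff (n - i)) *\<^sub>R b ^ n" if "i \<le> n" for i
      using that power_add[of b i "n - i"] by (simp add: f_def)
    then have "(\<Sum>i\<le>n. f i * f (n - i)) = (\<Sum>i\<le>n. sqrt_coeff i * sqrt_coeff (n - i)) *\<^sub>R b ^ n"
      unfolding scaleR_sum_left by (intro sum.cong) auto
    then show "(\<Sum>i\<le>n. f i * f (n - i)) = (if n = 0 then 1 else if n = 1 then -1 else 0) *\<^sub>R b ^ n"
      unfolding sqrt_coeff_convolution .
  qed
  also have "(\<Sum>n. (if n = 0 then 1 else if n = 1 then -1 else 0) *\<^sub>R b ^ n)
     = (\<Sum>n\<in>{0, 1::nat}. (if n = 0 then 1 else if n = 1 then -1 else 0) *\<^sub>R b ^ n)"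
    by (rule suminf_finite) auto
  also have "\<dots> = a" by (simp add: b_def)
  finally have kk: "k * k = a" .
  have "star k = (\<Sum>n. star (f n))"
    unfolding k_def by (rule bounded_linear.suminf[OF bounded_linear_star s])
  also have "\<dots> = k"
    unfolding k_def f_def by (simp add: star_scaleR star_power b_def star_diff sa)
  finally have sk: "star k = k" .
  \<comment> \<open>Once the constant term \<open>1\<close> is removed, the absolute values of the
    remaining coefficients add up to at most 1.\<close>
  have k1: "k - 1 = (\<Sum>n. f (Suc n))"
    using suminf_split_head[OF s] by (simp add: k_def f_def)
  have "norm (k - 1) \<le> (\<Sum>n. norm (f (Suc n)))"
    unfolding k1 by (rule summable_norm[OF sS])
  also have "\<dots> \<le> (\<Sum>n. \<bar>sqrt_coeff (Suc n)\<bar>)"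
    by (intro suminf_le sS summable_sqrt_coeff nf)
  also have "\<dots> \<le> 1"
    by (rule suminf_le_const[OF summable_sqrt_coeff sum_norm_sqrt_coeff])
  finally have "norm (1 - k) \<le> 1" by (simp add: norm_minus_commute)
  moreover have "c * k = k * c" if c: "c * a = a * c" for c
  proof -
    have "c * b = b * c" using c by (simp add: b_def algebra_simps)
    then have "c * b ^ n = b ^ n * c" for n
      by (induction n) (simp_all, metis mult.assoc)
    then have "c * f n = f n * c" for n by (simp add: f_def)
    then show ?thesis unfolding k_def by (simp add: suminf_mult[OF s, symmetric] suminf_mult2[OF s])
  qed
  ultimately show ?thesis using kk sk by blast
qed

text \<open>With \<open>y = (1 - a\<^sup>2)\<^sup>1\<^sup>/\<^sup>2\<close>, the element \<open>u = y + \<i>a\<close> is unitary and \<open>y\<close> is its real part.\<close>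

lemma norm_one_minus_square_le:
  fixes a :: "'a::unital_cstar_algebra"
  assumes sa: "star a = a" and na: "norm a \<le> 1"
  shows "norm (1 - a * a) \<le> 1"
proof -
  have "norm (1 - (1 - a * a)) \<le> 1"
    using norm_selfadjoint_square[OF sa] power_le_one[of "norm a" 2] na by simp
  moreover have "star (1 - a * a) = 1 - a * a" by (simp add: star_diff star_mult sa)
  moreover have "a * (1 - a * a) = (1 - a * a) * a" by (simp add: algebra_simps)
  ultimately obtain y where y: "star y = y" "y * y = 1 - a * a" "a * y = y * a"
    using selfadjoint_sqrt by metis
  define u where "u = y + scaleC \<i> a"
  have su: "star u = y - scaleC \<i> a"
    by (simp add: u_def star_add star_scaleC sa y scaleC_minus_left)
  have uu: "star u * u = 1"
    unfolding su by (simp add: u_def algebra_simps mult_scaleC_left mult_scaleC_right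
        scaleC_scaleC scaleC_minus_left scaleC_diff_right y)
  then have "(norm u)\<^sup>2 = 1" using cstar_identity[of u] by simp
  then have nu: "norm u = 1" using norm_ge_zero[of u] by (simp add: power2_eq_1_iff)
  have "2 *\<^sub>R y = u + star u"
    unfolding su by (simp add: u_def scaleR_2)
  then have "2 * norm y \<le> norm u + norm (star u)"
    by (metis norm_scaleR abs_numeral norm_triangle_ineq)
  then have "norm y \<le> 1" using nu by simp
  then have "norm (y * y) \<le> 1"
    unfolding norm_selfadjoint_square[OF y(1)] by (simp add: power_le_one)
  then show ?thesis using y by simp
qed

text \<open>Norm characterisation of positivity, chosen because closure under sums is immediate.\<close>

definition cstar_pos :: "'a::unital_cstar_algebra \<Rightarrow> bool" where
  "cstar_pos a \<longleftrightarrow> star a = a \<and> (\<exists>t\<ge>0. norm (t *\<^sub>R 1 - a) \<le> t)"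

lemma cstar_pos_add:
  assumes "cstar_pos a" "cstar_pos b" shows "cstar_pos (a + b)"
proof -
  obtain s t where "s \<ge> 0" "norm (s *\<^sub>R 1 - a) \<le> s" "t \<ge> 0" "norm (t *\<^sub>R 1 - b) \<le> t"
    using assms unfolding cstar_pos_def by blast
  moreover have "(s + t) *\<^sub>R 1 - (a + b) = (s *\<^sub>R 1 - a) + (t *\<^sub>R 1 - b)"
    by (simp add: scaleR_add_left)
  ultimately have "norm ((s + t) *\<^sub>R 1 - (a + b)) \<le> s + t \<and> s + t \<ge> 0"
    by (metis add_nonneg_nonneg norm_triangle_mono)
  then show ?thesis using assms unfolding cstar_pos_def by (metis star_add)
qed

lemma cstar_pos_0: "cstar_pos 0"
  unfolding cstar_pos_def by (auto intro: exI[of _ 0])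

text \<open>
  Positivity of \<open>d\<^sup>* d\<close> by way of the faithful trace: with \<open>h = d\<^sup>* d\<close>, \<open>g = \<bar>h\<bar>\<close> and \<open>w = g - h\<close>
  one has \<open>w h = - w g\<close>, so \<open>(d w)\<^sup>* (d w) = - w g w\<close>, and \<open>w = 0\<close> since both traces are nonnegative.
\<close>

lemma norm_one_minus_star_mult_self_le:
  fixes \<tau> :: "'a::unital_cstar_algebra \<Rightarrow> complex"
  assumes simple: "simple_cstar TYPE('a)" and tr: "tracial_state \<tau>" and nd: "norm d \<le> (1::real)"
  shows "norm (1 - star d * (d::'a)) \<le> 1"
proof -
  define h where "h = star d * d"
  have sh: "star h = h" by (simp add: h_def star_mult star_star)
  have "norm h \<le> 1" using nd by (simp add: h_def cstar_identity power_le_one)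
  then have "norm (1 - h * h) \<le> 1" by (rule norm_one_minus_square_le[OF sh])
  moreover have "star (h * h) = h * h" by (simp add: star_mult sh)
  moreover have "h * (h * h) = h * h * h" by (simp add: mult.assoc)
  ultimately obtain g where g: "star g = g" "g * g = h * h" "norm (1 - g) \<le> 1" "h * g = g * h"
    using selfadjoint_sqrt[of "h * h"] by blast
  \<comment> \<open>\<open>g\<close> satisfies the norm bound again; its root \<open>k\<close>
    exhibits \<open>w * g * w\<close> in the form \<open>star x * x\<close>, with
    \<open>x = k * w\<close>.\<close>
  then obtain k where k: "star k = k" "k * k = g"
    using selfadjoint_sqrt[of g] by blast
  define w where "w = g - h"
  have sw: "star w = w" by (simp add: w_def star_diff g sh)
  have wg: "w * h = - (w * g)" using g(2,4) by (simp add: w_def algebra_simps)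
  have 1: "star (d * w) * (d * w) = w * h * w"
    by (simp add: star_mult sw h_def mult.assoc)
  have 2: "star (k * w) * (k * w) = w * g * w"
    by (simp add: star_mult sw k(1) mult.assoc flip: k(2))
  have add: "\<tau> (x + y) = \<tau> x + \<tau> y" for x y using tr by (simp add: tracial_state_def)
  have nn: "0 \<le> \<tau> (star x * x)" for x using tr unfolding tracial_state_def by blast
  have "\<tau> (star (d * w) * (d * w)) + \<tau> (star (k * w) * (k * w)) = 0"
    unfolding add[symmetric] 1 2 wg using tracial_state_0[OF tr] by simp
  then have "\<tau> (star (k * w) * (k * w)) = 0"
    using nn[of "d * w"] nn[of "k * w"] by (simp add: less_eq_complex_def complex_eq_iff)
  then have "k * w = 0" by (rule tracial_state_faithful[OF simple tr])
  then have "w * g * w = 0" using 2 by simp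
  moreover from this have "w * h * w = 0" unfolding wg by simp
  moreover have "w * (g - h) * w = w * g * w - w * h * w" by (simp add: algebra_simps)
  ultimately have "w * (w * w) = 0" by (simp add: mult.assoc flip: w_def)
  \<comment> \<open>A selfadjoint nilpotent is zero: the C*-identity takes the fourth power of
    \<open>w\<close> down to its square, and the square down to \<open>w\<close>.\<close>
  then have "(w * w) * (w * w) = 0" by (metis mult.assoc mult_zero_right)
  then have "norm (w * w) = 0"
    using norm_selfadjoint_square[of "w * w"] by (simp add: star_mult sw)
  then have "w = 0" using norm_selfadjoint_square[OF sw] by simp
  then have "g = h" by (simp add: w_def)
  then show ?thesis using g(3) by (simp add: h_def)
qed

lemma cstar_pos_star_mult_self:
  fixes \<tau> :: "'a::unital_cstar_algebra \<Rightarrow> complex"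
  assumes simple: "simple_cstar TYPE('a)" and tr: "tracial_state \<tau>"
  shows "cstar_pos (star d * (d::'a))"
proof (cases "d = 0")
  case False
  define n where "n = norm d"
  have n: "n > 0" using False by (simp add: n_def)
  define e where "e = (1 / n) *\<^sub>R d"
  have de: "d = n *\<^sub>R e" using n by (simp add: e_def)
  have "norm e \<le> 1" using n by (simp add: e_def n_def)
  then have "norm (1 - star e * e) \<le> 1" by (rule norm_one_minus_star_mult_self_le[OF simple tr])
  moreover have "(n * n) *\<^sub>R 1 - star d * d = (n * n) *\<^sub>R (1 - star e * e)"
    unfolding de by (simp add: star_scaleR scaleR_diff_right)
  ultimately have "norm ((n * n) *\<^sub>R 1 - star d * d) \<le> n * n"
    using n by (simp add: mult_left_le)
  then show ?thesis
    unfolding cstar_pos_def by (auto simp: star_mult star_star intro!: exI[of _ "n * n"])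
qed (simp add: cstar_pos_0)

lemma cstar_pos_sum: "(\<And>i. i \<in> A \<Longrightarrow> cstar_pos (f i)) \<Longrightarrow> cstar_pos (sum f A)"
  by (induction A rule: infinite_finite_induct) (auto simp: cstar_pos_0 cstar_pos_add)

text \<open>Division by \<open>t + 1\<close> turns \<open>1 + a\<close> into \<open>h\<close> with
  \<open>1 - h = (t - a) / (t + 1)\<close>, of norm at most \<open>t / (t + 1) < 1\<close>. So
  \<open>h\<close> has a square root \<open>r\<close> and, by the Neumann series, an inverse;
  \<open>s\<close> is a multiple of the inverse of \<open>r\<close>.\<close>

lemma cstar_pos_inverse_sqrt:
  fixes a :: "'a::unital_cstar_algebra"
  assumes "cstar_pos a"
  shows "\<exists>s. star s * (1 + a) * s = 1"
proof -
  obtain t where t: "t \<ge> 0" "norm (t *\<^sub>R 1 - a) \<le> t" and sa: "star a = a"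
    using assms unfolding cstar_pos_def by blast
  define h where "h = (1 / (t + 1)) *\<^sub>R (1 + a)"
  have "1 - h = (1 / (t + 1)) *\<^sub>R (t *\<^sub>R 1 - a)"
  proof -
    have "(1::'a) = (1 / (t + 1)) *\<^sub>R ((t + 1) *\<^sub>R 1)" using t by simp
    then have "1 - h = (1 / (t + 1)) *\<^sub>R ((t + 1) *\<^sub>R 1 - (1 + a))"
      unfolding h_def scaleR_diff_right by metis
    then show ?thesis by (simp add: scaleR_add_left)
  qed
  then have "norm (1 - h) \<le> t / (t + 1)"
    using t by (simp add: divide_right_mono)
  also have "\<dots> < 1" using t by simp
  finally have nh: "norm (1 - h) < 1" .
  have "star h = h" by (simp add: h_def star_scaleR star_add sa)
  then obtain r where r: "star r = r" "r * r = h"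
    using selfadjoint_sqrt[of h] nh by auto
  obtain v where v: "h * v = 1" "v * h = 1" using near_one_invertible[OF nh] by blast
  define q where "q = r * v"
  have rq: "r * q = 1" using v r by (simp add: q_def flip: mult.assoc)
  have "v * r * r = 1" using v r by (simp add: mult.assoc)
  then have "v * r = q" by (metis mult.assoc mult_1_left mult_1_right rq)
  then have qr: "q * r = 1" using \<open>v * r * r = 1\<close> by simp
  have "star q * r = 1" using arg_cong[OF rq, of star] by (simp add: star_mult r)
  have "star q * h * q = (star q * r) * (r * q)" by (simp add: mult.assoc flip: r(2))
  then have "star q * h * q = 1" using \<open>star q * r = 1\<close> rq by simp
  moreover have "star (c *\<^sub>R q) * (1 + a) * (c *\<^sub>R q) = (c * c) *\<^sub>R (star q * (1 + a) * q)" for c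
    by (simp add: star_scaleR)
  moreover have "star q * h * q = (1 / (t + 1)) *\<^sub>R (star q * (1 + a) * q)"
    by (simp add: h_def)
  \<comment> \<open>The factor \<open>1 / (t + 1)\<close> is shared between the two copies of
    \<open>s\<close>.\<close>
  moreover have "sqrt (1 / (t + 1)) * sqrt (1 / (t + 1)) = 1 / (t + 1)" using t by simp
  ultimately show ?thesis by metis
qed

section \<open>Matrices over the algebra and corners\<close>

lemma mult_mat_index:
  assumes "A \<in> carrier_mat n m" "B \<in> carrier_mat m k" "i < n" "j < k"
  shows "(A * B) $$ (i, j) = (\<Sum>l<m. A $$ (i, l) * B $$ (l, j))"
  using assms by (auto simp: scalar_prod_def atLeast0LessThan intro!: sum.cong)

lemma mult_carrier_square [simp, intro]:
  "A \<in> carrier_mat n n \<Longrightarrow> B \<in> carrier_mat n n \<Longrightarrow> A * B \<in> carrier_mat n n"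
  by (rule mult_carrier_mat)

lemma mat_star_carrier [simp, intro]:
  "A \<in> carrier_mat n m \<Longrightarrow> mat_star A \<in> carrier_mat m n"
  by (auto simp: mat_star_def)

lemma mat_star_index:
  "A \<in> carrier_mat n m \<Longrightarrow> i < m \<Longrightarrow> j < n \<Longrightarrow> mat_star A $$ (i, j) = star (A $$ (j, i))"
  by (auto simp: mat_star_def)

lemma mat_star_mult:
  assumes "A \<in> carrier_mat n m" "B \<in> carrier_mat m k"
  shows "mat_star (A * B) = mat_star B * mat_star A"
proof (rule eq_matI)
  have c: "mat_star B * mat_star A \<in> carrier_mat k n" "A * B \<in> carrier_mat n k"
    using assms by (auto intro!: mult_carrier_mat[of _ _ m])
  fix i j assume "i < dim_row (mat_star B * mat_star A)" "j < dim_col (mat_star B * mat_star A)"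
  then have "i < k" "j < n" using c by auto
  then show "mat_star (A * B) $$ (i, j) = (mat_star B * mat_star A) $$ (i, j)"
    using assms c by (simp add: mat_star_index[of _ n k] mult_mat_index[of _ n m _ k]
        mult_mat_index[of _ k m _ n] star_sum star_mult mat_star_index[of B m k]
        mat_star_index[of A n m] del: index_mult_mat)
qed (use assms in \<open>auto simp: mat_star_def\<close>)

lemma mat_scaleC_carrier [simp]: "mat_scaleC c A \<in> carrier_mat n m \<longleftrightarrow> A \<in> carrier_mat n m"
  by (auto simp: mat_scaleC_def)

lemma mat_scaleC_index:
  "A \<in> carrier_mat n m \<Longrightarrow> i < n \<Longrightarrow> j < m \<Longrightarrow> mat_scaleC c A $$ (i, j) = scaleC c (A $$ (i, j))"
  by (auto simp: mat_scaleC_def)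

lemma mat_trace_commute:
  assumes tr: "tracial_state \<tau>" and "A \<in> carrier_mat n m" "B \<in> carrier_mat m n"
  shows "mat_trace \<tau> n (A * B) = mat_trace \<tau> m (B * A)"
proof -
  have comm: "\<tau> (a * b) = \<tau> (b * a)" for a b using tr unfolding tracial_state_def by blast
  have "mat_trace \<tau> n (A * B) = (\<Sum>i<n. \<Sum>l<m. \<tau> (A $$ (i, l) * B $$ (l, i)))"
    unfolding mat_trace_def
    using assms by (intro sum.cong refl) (simp add: mult_mat_index[of _ n m _ n] tracial_state_sum del: index_mult_mat)
  also have "\<dots> = (\<Sum>l<m. \<Sum>i<n. \<tau> (B $$ (l, i) * A $$ (i, l)))"
    unfolding comm[of "A $$ _"] by (rule sum.swap)
  also have "\<dots> = mat_trace \<tau> m (B * A)"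
    unfolding mat_trace_def
    using assms by (intro sum.cong refl) (simp add: mult_mat_index[of _ m n _ m] tracial_state_sum del: index_mult_mat)
  finally show ?thesis .
qed

lemma mat_trace_star_mult:
  assumes "tracial_state \<tau>" "A \<in> carrier_mat m n"
  shows "mat_trace \<tau> n (mat_star A * A) = (\<Sum>i<n. \<Sum>l<m. \<tau> (star (A $$ (l, i)) * A $$ (l, i)))"
  unfolding mat_trace_def using assms
  by (intro sum.cong refl) (simp add: mult_mat_index[of _ n m _ n] tracial_state_sum mat_star_index[of _ m n] del: index_mult_mat)

lemma mat_trace_star_mult_nonneg:
  assumes "tracial_state \<tau>" "A \<in> carrier_mat m n"
  shows "0 \<le> mat_trace \<tau> n (mat_star A * A)"
  unfolding mat_trace_star_mult[OF assms]
  using assms(1) unfolding tracial_state_def by (intro sum_nonneg) blast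

text \<open>A flat index \<open>e\<close> stands for position \<open>e mod n\<close> in block
  \<open>e div n\<close>; the block computations below reduce to this reindexing.\<close>

lemma sum_div_mod:
  fixes f :: "nat \<Rightarrow> nat \<Rightarrow> 'b::comm_monoid_add"
  shows "(\<Sum>e<k * n. f (e div n) (e mod n)) = (\<Sum>c<k. \<Sum>d<n. f c d)"
proof -
  have "(\<Sum>e<k * n. f (e div n) (e mod n)) = (\<Sum>c<k. \<Sum>e = c * n..<c * n + n. f (e div n) (e mod n))"
    by (simp add: sum.nat_group)
  also have "\<dots> = (\<Sum>c<k. \<Sum>d<n. f c d)"
  proof (rule sum.cong[OF refl])
    fix c
    have "(\<Sum>e = c * n..<c * n + n. f (e div n) (e mod n))
        = (\<Sum>d\<in>{0..<n}. f ((d + c * n) div n) ((d + c * n) mod n))"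
      using sum.shift_bounds_nat_ivl[of "\<lambda>e. f (e div n) (e mod n)" 0 "c * n" n]
      by (simp add: add.commute)
    also have "\<dots> = (\<Sum>d<n. f c d)" by (rule sum.cong) auto
    finally show "(\<Sum>e = c * n..<c * n + n. f (e div n) (e mod n)) = (\<Sum>d<n. f c d)" .
  qed
  finally show ?thesis .
qed

lemma div_mod_less: "i < m * n \<Longrightarrow> i div n < m \<and> i mod n < (n::nat)"
  by (metis less_mult_imp_div_less mod_less_divisor mult_0_right not_gr_zero not_less_zero)

lemma block_index_less:
  assumes "i < m" "a < n" shows "i * n + a < m * (n::nat)"
proof -
  have "i * n + a < Suc i * n" using assms by simp
  also have "\<dots> \<le> m * n" using assms by (intro mult_le_mono) auto
  finally show ?thesis .
qed

section \<open>Entrywise amplification of an isomorphism onto a corner\<close>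

locale corner_isomorphism =
  fixes n :: nat and p :: "'a::unital_cstar_algebra mat" and \<phi> :: "'a \<Rightarrow> 'a mat"
  assumes proj: "mat_projection n p"
    and iso: "star_isomorphism_onto \<phi> (corner n p)"
begin

lemma p_carrier [simp, intro]: "p \<in> carrier_mat n n"
  and p_idem: "p * p = p" and p_star: "mat_star p = p"
  using proj by (auto simp: mat_projection_def)

lemma add: "\<phi> (x + y) = \<phi> x + \<phi> y"
  and scaleC: "\<phi> (scaleC c x) = mat_scaleC c (\<phi> x)"
  and mult: "\<phi> (x * y) = \<phi> x * \<phi> y"
  and star: "\<phi> (star x) = mat_star (\<phi> x)"
  and inj: "inj \<phi>" and range: "range \<phi> = corner n p"
  using iso by (auto simp: star_isomorphism_onto_def bij_betw_def)

lemma carrier [simp, intro]: "\<phi> x \<in> carrier_mat n n"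
proof -
  have "\<phi> x \<in> corner n p" using range by blast
  then show ?thesis by (auto simp: corner_def intro!: mult_carrier_mat[of _ n n])
qed

lemma mult_p: "\<phi> x * p = \<phi> x"
proof -
  have "\<phi> x \<in> corner n p" using range by blast
  then obtain X where X: "X \<in> carrier_mat n n" "\<phi> x = p * X * p"
    by (auto simp: corner_def)
  have "(p * X * p) * p = p * X * (p * p)"
    using X(1) by (simp add: assoc_mult_mat[of _ n n _ n _ n])
  then show ?thesis using X p_idem by simp
qed

lemma surj: "X \<in> carrier_mat n n \<Longrightarrow> \<exists>x. \<phi> x = p * X * p"
proof -
  assume "X \<in> carrier_mat n n"
  then have "p * X * p \<in> range \<phi>" unfolding range corner_def by blast
  then show ?thesis by (metis imageE)
qed

text \<open>\<open>p\<close> is itself of the form \<open>p * X * p\<close>, hence a value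
  \<open>\<phi> e\<close>; as it is a right unit on the range, it agrees with the image of
  \<open>1\<close>.\<close>

lemma one: "\<phi> 1 = p"
proof -
  obtain e where e: "\<phi> e = p * p * p" using surj by blast
  then have "\<phi> e = p" by (simp add: p_idem)
  then show ?thesis using mult[of 1 e] mult_p[of 1] by simp
qed

lemma zero: "\<phi> 0 = 0\<^sub>m n n"
proof -
  have "\<phi> 0 = mat_scaleC 0 (\<phi> 0)" using scaleC[of 0 0] by simp
  also have "\<dots> = 0\<^sub>m n n"
    by (rule eq_matI) (auto simp: mat_scaleC_def carrier_matD[OF carrier])
  finally show ?thesis .
qed

lemma sum_index:
  assumes "i < n" "j < n"
  shows "\<phi> (sum f A) $$ (i, j) = (\<Sum>a\<in>A. \<phi> (f a) $$ (i, j))"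
  by (induction A rule: infinite_finite_induct)
    (use assms in \<open>auto simp: zero add index_add_mat(1) carrier_matD[OF carrier]\<close>)

text \<open>The map id tensor \<open>\<phi>\<close> from matrices over A to matrices over M_n(A),
  flattened so that row \<open>i\<close> is row \<open>i mod n\<close> of block row
  \<open>i div n\<close>.\<close>

definition amp :: "'a mat \<Rightarrow> 'a mat" where
  "amp x = Matrix.mat (dim_row x * n) (dim_col x * n)
     (\<lambda>(i, j). \<phi> (x $$ (i div n, j div n)) $$ (i mod n, j mod n))"

lemma amp_carrier [simp, intro]: "x \<in> carrier_mat m k \<Longrightarrow> amp x \<in> carrier_mat (m * n) (k * n)"
  by (auto simp: amp_def)

lemma amp_index:
  assumes "x \<in> carrier_mat m k" "i < m * n" "j < k * n"
  shows "amp x $$ (i, j) = \<phi> (x $$ (i div n, j div n)) $$ (i mod n, j mod n)"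
  using assms by (auto simp: amp_def)

lemma amp_mult:
  assumes x: "x \<in> carrier_mat m k" and y: "y \<in> carrier_mat k l"
  shows "amp (x * y) = amp x * amp y"
proof (rule eq_matI)
  have c: "amp x * amp y \<in> carrier_mat (m * n) (l * n)" "x * y \<in> carrier_mat m l"
    using mult_carrier_mat[OF amp_carrier[OF x] amp_carrier[OF y]] x y by auto
  fix i j assume "i < dim_row (amp x * amp y)" "j < dim_col (amp x * amp y)"
  then have ij: "i < m * n" "j < l * n" using c by auto
  note d = div_mod_less[OF ij(1)] div_mod_less[OF ij(2)]
  have "(amp x * amp y) $$ (i, j) = (\<Sum>e<k * n. amp x $$ (i, e) * amp y $$ (e, j))"
    by (rule mult_mat_index[OF amp_carrier[OF x] amp_carrier[OF y] ij])
  also have "\<dots> = (\<Sum>e<k * n. \<phi> (x $$ (i div n, e div n)) $$ (i mod n, e mod n)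
      * \<phi> (y $$ (e div n, j div n)) $$ (e mod n, j mod n))"
    using ij by (intro sum.cong refl) (simp add: amp_index[OF x] amp_index[OF y])
  also have "\<dots> = (\<Sum>c<k. \<Sum>d<n. \<phi> (x $$ (i div n, c)) $$ (i mod n, d)
      * \<phi> (y $$ (c, j div n)) $$ (d, j mod n))"
    by (rule sum_div_mod)
  also have "\<dots> = (\<Sum>c<k. \<phi> (x $$ (i div n, c) * y $$ (c, j div n)) $$ (i mod n, j mod n))"
    unfolding mult using d by (intro sum.cong refl mult_mat_index[symmetric, OF carrier carrier]) auto
  also have "\<dots> = amp (x * y) $$ (i, j)"
    using d by (simp add: amp_index[OF c(2) ij] mult_mat_index[OF x y] sum_index del: index_mult_mat)
  finally show "amp (x * y) $$ (i, j) = (amp x * amp y) $$ (i, j)" by simp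
qed (use x y in \<open>auto simp: amp_def\<close>)

lemma amp_add:
  assumes x: "x \<in> carrier_mat m k" and y: "y \<in> carrier_mat m k"
  shows "amp (x + y) = amp x + amp y"
proof (rule eq_matI)
  fix i j assume "i < dim_row (amp x + amp y)" "j < dim_col (amp x + amp y)"
  then have ij: "i < m * n" "j < k * n" using x y by (auto simp: amp_def)
  show "amp (x + y) $$ (i, j) = (amp x + amp y) $$ (i, j)"
    using x y div_mod_less[OF ij(1)] div_mod_less[OF ij(2)] ij
    by (simp add: amp_def add carrier_matD[OF carrier])
qed (use x y in \<open>auto simp: amp_def\<close>)

lemma amp_scaleC:
  assumes x: "x \<in> carrier_mat m k"
  shows "amp (mat_scaleC c x) = mat_scaleC c (amp x)"
proof (rule eq_matI)
  fix i j assume "i < dim_row (mat_scaleC c (amp x))" "j < dim_col (mat_scaleC c (amp x))"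
  then have ij: "i < m * n" "j < k * n" using x by (auto simp: amp_def mat_scaleC_def)
  show "amp (mat_scaleC c x) $$ (i, j) = mat_scaleC c (amp x) $$ (i, j)"
    using x div_mod_less[OF ij(1)] div_mod_less[OF ij(2)] ij
    by (simp add: amp_def mat_scaleC_index[OF x] scaleC mat_scaleC_index[OF carrier])
      (simp add: mat_scaleC_def)
qed (use x in \<open>auto simp: amp_def mat_scaleC_def\<close>)

lemma amp_star:
  assumes x: "x \<in> carrier_mat m k"
  shows "amp (mat_star x) = mat_star (amp x)"
proof (rule eq_matI)
  fix i j assume "i < dim_row (mat_star (amp x))" "j < dim_col (mat_star (amp x))"
  then have ij: "i < k * n" "j < m * n" using x by (auto simp: amp_def mat_star_def)
  show "amp (mat_star x) $$ (i, j) = mat_star (amp x) $$ (i, j)"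
    using x div_mod_less[OF ij(1)] div_mod_less[OF ij(2)] ij
    by (simp add: amp_index[OF mat_star_carrier[OF x]] mat_star_index[OF amp_carrier[OF x]]
        mat_star_index[OF x] star mat_star_index[OF carrier] amp_index[OF x])
qed (use x in \<open>auto simp: amp_def mat_star_def\<close>)

lemma amp_inj:
  assumes x: "x \<in> carrier_mat m k" and y: "y \<in> carrier_mat m k" and eq: "amp x = amp y"
  shows "x = y"
proof (rule eq_matI)
  fix i j assume "i < dim_row y" "j < dim_col y"
  then have ij: "i < m" "j < k" using y by auto
  have "\<phi> (x $$ (i, j)) = \<phi> (y $$ (i, j))"
  proof (rule eq_matI)
    fix a b assume "a < dim_row (\<phi> (y $$ (i, j)))" "b < dim_col (\<phi> (y $$ (i, j)))"
    then have ab: "a < n" "b < n" by (simp_all add: carrier_matD[OF carrier])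
    have l: "i * n + a < m * n" "j * n + b < k * n"
      using ij ab by (simp_all add: block_index_less)
    show "\<phi> (x $$ (i, j)) $$ (a, b) = \<phi> (y $$ (i, j)) $$ (a, b)"
      using arg_cong[OF eq, of "\<lambda>z. z $$ (i * n + a, j * n + b)"] ab
      by (simp add: amp_index[OF x l] amp_index[OF y l])
  qed (simp_all add: carrier_matD[OF carrier])
  then show "x $$ (i, j) = y $$ (i, j)" using inj by (simp add: inj_eq)
qed (use x y in auto)

text \<open>By \<open>one\<close> and \<open>zero\<close> this is diag(p, ..., p) with
  \<open>m\<close> blocks, the unit of the image under \<open>amp\<close> of the square matrices of
  size \<open>m\<close>.\<close>

abbreviation unit_amp :: "nat \<Rightarrow> 'a mat" where "unit_amp m \<equiv> amp (1\<^sub>m m)"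

lemma unit_amp_index:
  assumes "i < m * n" "j < m * n"
  shows "unit_amp m $$ (i, j) = (if i div n = j div n then p $$ (i mod n, j mod n) else 0)"
  using assms div_mod_less[OF assms(1)] div_mod_less[OF assms(2)]
  by (simp add: amp_index[of _ m m] one zero)

lemma unit_amp_mult_index:
  assumes X: "X \<in> carrier_mat (m * n) k" and i: "i < m * n" and j: "j < k"
  shows "(unit_amp m * X) $$ (i, j) = (\<Sum>d<n. p $$ (i mod n, d) * X $$ (i div n * n + d, j))"
proof -
  have "(unit_amp m * X) $$ (i, j) = (\<Sum>e<m * n. unit_amp m $$ (i, e) * X $$ (e, j))"
    using X i j by (intro mult_mat_index[of _ "m * n" "m * n" _ k]) auto
  also have "\<dots> = (\<Sum>e<m * n. (if i div n = e div n then p $$ (i mod n, e mod n) else 0)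
      * X $$ ((e div n) * n + e mod n, j))"
    using i by (intro sum.cong refl) (simp add: unit_amp_index)
  also have "\<dots> = (\<Sum>c<m. \<Sum>d<n. (if i div n = c then p $$ (i mod n, d) else 0) * X $$ (c * n + d, j))"
    by (rule sum_div_mod)
  also have "\<dots> = (\<Sum>c<m. if i div n = c then \<Sum>d<n. p $$ (i mod n, d) * X $$ (c * n + d, j) else 0)"
    by (intro sum.cong) auto
  also have "\<dots> = (\<Sum>d<n. p $$ (i mod n, d) * X $$ (i div n * n + d, j))"
    using div_mod_less[OF i] by (simp add: sum.delta)
  finally show ?thesis .
qed

lemma mult_unit_amp_index:
  assumes X: "X \<in> carrier_mat k (m * n)" and i: "i < k" and j: "j < m * n"
  shows "(X * unit_amp m) $$ (i, j) = (\<Sum>d<n. X $$ (i, j div n * n + d) * p $$ (d, j mod n))"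
proof -
  have "(X * unit_amp m) $$ (i, j) = (\<Sum>e<m * n. X $$ (i, e) * unit_amp m $$ (e, j))"
    using X i j by (intro mult_mat_index[of _ k "m * n" _ "m * n"]) auto
  also have "\<dots> = (\<Sum>e<m * n. X $$ (i, (e div n) * n + e mod n)
      * (if e div n = j div n then p $$ (e mod n, j mod n) else 0))"
    using j by (intro sum.cong refl) (simp add: unit_amp_index)
  also have "\<dots> = (\<Sum>c<m. \<Sum>d<n. X $$ (i, c * n + d) * (if c = j div n then p $$ (d, j mod n) else 0))"
    by (rule sum_div_mod)
  also have "\<dots> = (\<Sum>c<m. if c = j div n then \<Sum>d<n. X $$ (i, c * n + d) * p $$ (d, j mod n) else 0)"
    by (intro sum.cong) auto
  also have "\<dots> = (\<Sum>d<n. X $$ (i, j div n * n + d) * p $$ (d, j mod n))"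
    using div_mod_less[OF j] by (simp add: sum.delta)
  finally show ?thesis .
qed

text \<open>Compression by diag(p, ..., p) replaces each block \<open>blk a b\<close> of
  \<open>X\<close> by \<open>p * blk a b * p\<close>, which lies in the range of
  \<open>\<phi>\<close>.\<close>

lemma amp_surj:
  assumes X: "X \<in> carrier_mat (m * n) (m * n)"
  shows "\<exists>y\<in>carrier_mat m m. amp y = unit_amp m * X * unit_amp m"
proof -
  define blk where "blk a b = Matrix.mat n n (\<lambda>(i, j). X $$ (a * n + i, b * n + j))" for a b
  have blk: "blk a b \<in> carrier_mat n n" for a b by (simp add: blk_def)
  have blk_index: "blk a b $$ (i, j) = X $$ (a * n + i, b * n + j)" if "i < n" "j < n" for a b i j
    using that by (simp add: blk_def)
  have "\<exists>x. \<phi> x = p * blk a b * p" for a b by (rule surj[OF blk])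
  then obtain f where f: "\<phi> (f a b) = p * blk a b * p" for a b by metis
  define y where "y = Matrix.mat m m (\<lambda>(a, b). f a b)"
  have y: "y \<in> carrier_mat m m" by (simp add: y_def)
  have PX: "unit_amp m * X \<in> carrier_mat (m * n) (m * n)"
    using X by (intro mult_carrier_square) auto
  have "amp y = unit_amp m * X * unit_amp m"
  proof (rule eq_matI)
    have c: "unit_amp m * X * unit_amp m \<in> carrier_mat (m * n) (m * n)"
      by (rule mult_carrier_square[OF PX]) auto
    fix i j assume "i < dim_row (unit_amp m * X * unit_amp m)" "j < dim_col (unit_amp m * X * unit_amp m)"
    then have ij: "i < m * n" "j < m * n" using c by auto
    note d = div_mod_less[OF ij(1)] div_mod_less[OF ij(2)]
    have l: "j div n * n + e < m * n" if "e < n" for e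
      using d that by (simp add: block_index_less)
    have "(unit_amp m * X * unit_amp m) $$ (i, j)
      = (\<Sum>e<n. (unit_amp m * X) $$ (i, j div n * n + e) * p $$ (e, j mod n))"
      by (rule mult_unit_amp_index[OF PX ij])
    also have "\<dots> = (\<Sum>e<n. (p * blk (i div n) (j div n)) $$ (i mod n, e) * p $$ (e, j mod n))"
      using d ij l by (intro sum.cong refl)
        (simp add: unit_amp_mult_index[OF X] mult_mat_index[OF p_carrier blk] blk_index del: index_mult_mat)
    also have "\<dots> = (p * blk (i div n) (j div n) * p) $$ (i mod n, j mod n)"
      using d by (intro mult_mat_index[symmetric] mult_carrier_mat[OF _ blk]) auto
    also have "\<dots> = amp y $$ (i, j)"
      using d by (simp add: amp_index[OF y ij] f[symmetric]) (simp add: y_def)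
    finally show "amp y $$ (i, j) = (unit_amp m * X * unit_amp m) $$ (i, j)" by simp
  qed (use X in \<open>auto simp: amp_def y_def\<close>)
  then show ?thesis using y by blast
qed

end

lemma mat_star_one: "mat_star (1\<^sub>m m) = (1\<^sub>m m :: 'a::unital_cstar_algebra mat)"
  by (rule eq_matI) (auto simp: mat_star_def)

text \<open>Since \<open>p = mat_star p * p\<close>, the trace is a sum of nonnegative numbers
  \<open>\<tau> (star x * x)\<close> over all entries \<open>x\<close>, so faithfulness on A can be
  applied to each entry.\<close>

lemma mat_trace_zero_imp_zero:
  assumes "simple_cstar TYPE('a)" "tracial_state \<tau>" and p: "mat_projection n (p::'a::unital_cstar_algebra mat)"
    and 0: "mat_trace \<tau> n p = 0"
  shows "p = 0\<^sub>m n n"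
proof -
  have c: "p \<in> carrier_mat n n" and eq: "p = mat_star p * p"
    using p by (auto simp: mat_projection_def)
  have nn: "0 \<le> \<tau> (star x * x)" for x using assms(2) unfolding tracial_state_def by blast
  have "(\<Sum>i<n. \<Sum>l<n. \<tau> (star (p $$ (l, i)) * p $$ (l, i))) = 0"
    using 0 mat_trace_star_mult[OF assms(2) c] eq by simp
  then have "\<forall>i<n. \<forall>l<n. \<tau> (star (p $$ (l, i)) * p $$ (l, i)) = 0"
    by (simp add: sum_nonneg_eq_0_iff sum_nonneg nn)
  then have "p $$ (l, i) = 0" if "l < n" "i < n" for l i
    using that tracial_state_faithful[OF assms(1,2)] by blast
  then show ?thesis using c by (intro eq_matI) auto
qed

context corner_isomorphism
begin

lemma unit_amp_amp:
  assumes "x \<in> carrier_mat m k"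
  shows "unit_amp m * amp x = amp x"
  using assms amp_mult[of "1\<^sub>m m" m m x k] by simp

lemma amp_unit_amp:
  assumes "x \<in> carrier_mat m k"
  shows "amp x * unit_amp k = amp x"
  using assms amp_mult[of x m k "1\<^sub>m k" k] by simp

lemma amp_projection: "mat_projection m q \<Longrightarrow> mat_projection (m * n) (amp q)"
  unfolding mat_projection_def using amp_mult[of q m m q m] amp_star[of q m m] by auto

text \<open>\<open>amp q\<close> absorbs the block diagonal unit on both sides, so an arbitrary
  \<open>X\<close> may first be compressed by it, and \<open>amp_surj\<close> then supplies a
  preimage.\<close>

lemma amp_corner:
  assumes q: "mat_projection m q"
  shows "amp ` corner m q = corner (m * n) (amp q)"
proof (intro subset_antisym subsetI)
  have qc: "q \<in> carrier_mat m m" using q by (simp add: mat_projection_def)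
  have conj: "amp (q * x * q) = amp q * amp x * amp q" if "x \<in> carrier_mat m m" for x
    using that qc by (simp add: amp_mult[of _ m m _ m] del: assoc_mult_mat)
  { fix X assume "X \<in> amp ` corner m q"
    then show "X \<in> corner (m * n) (amp q)" using conj unfolding corner_def by blast }
  fix Y assume "Y \<in> corner (m * n) (amp q)"
  then obtain X where X: "X \<in> carrier_mat (m * n) (m * n)" "Y = amp q * X * amp q"
    unfolding corner_def by blast
  obtain y where y: "y \<in> carrier_mat m m" "amp y = unit_amp m * X * unit_amp m"
    using amp_surj[OF X(1)] by blast
  have "Y = amp q * (unit_amp m * X * unit_amp m) * amp q"
  proof -
    have aq: "amp q \<in> carrier_mat (m * n) (m * n)" "unit_amp m \<in> carrier_mat (m * n) (m * n)"
      using qc by auto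
    have "amp q * (unit_amp m * X * unit_amp m) * amp q
        = (amp q * unit_amp m) * X * (unit_amp m * amp q)"
      using aq X(1) by (simp add: assoc_mult_mat[of _ "m * n" "m * n" _ "m * n" _ "m * n"])
    then show ?thesis using X(2) by (simp add: unit_amp_amp[OF qc] amp_unit_amp[OF qc])
  qed
  then have "Y = amp (q * y * q)" using conj[OF y(1)] y(2) by simp
  then show "Y \<in> amp ` corner m q" unfolding corner_def using y(1) by blast
qed

lemma compose_amp:
  assumes "corner_isomorphism m q \<psi>"
  shows "corner_isomorphism (m * n) (amp q) (amp \<circ> \<psi>)"
proof -
  interpret Q: corner_isomorphism m q \<psi> by fact
  have "inj_on amp (carrier_mat m m)" by (auto intro: inj_onI amp_inj)
  then have "inj (amp \<circ> \<psi>)"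
    using Q.inj by (intro comp_inj_on) (auto elim: inj_on_subset)
  moreover have "range (amp \<circ> \<psi>) = corner (m * n) (amp q)"
    using amp_corner[OF Q.proj] Q.range by (metis image_comp)
  ultimately have "star_isomorphism_onto (amp \<circ> \<psi>) (corner (m * n) (amp q))"
    unfolding star_isomorphism_onto_def bij_betw_def
    by (simp add: Q.add Q.scaleC Q.mult Q.star amp_add[OF Q.carrier Q.carrier]
        amp_scaleC[OF Q.carrier] amp_mult[OF Q.carrier Q.carrier] amp_star[OF Q.carrier])
  then show ?thesis using amp_projection[OF Q.proj] by (simp add: corner_isomorphism_def)
qed

end

section \<open>Behaviour of the trace under an isomorphism onto a corner\<close>

locale unique_trace_corner = corner_isomorphism n p \<phi>
  for n p and \<phi> :: "'a::unital_cstar_algebra \<Rightarrow> 'a mat" +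
  fixes \<tau> :: "'a \<Rightarrow> complex"
  assumes simple: "simple_cstar TYPE('a)"
    and trace: "tracial_state \<tau>"
    and unique: "\<And>\<sigma> :: 'a \<Rightarrow> complex. tracial_state \<sigma> \<Longrightarrow> \<sigma> = \<tau>"
begin

lemma p_nonzero: "p \<noteq> 0\<^sub>m n n"
proof
  assume "p = 0\<^sub>m n n"
  then have "\<phi> 1 = \<phi> 0" using one zero by simp
  then show False using inj by (auto dest: injD)
qed

lemma trace_pos: "0 < mat_trace \<tau> n p"
proof -
  have "0 \<le> mat_trace \<tau> n (mat_star p * p)"
    by (rule mat_trace_star_mult_nonneg[OF trace p_carrier])
  moreover have "mat_trace \<tau> n p \<noteq> 0"
    using mat_trace_zero_imp_zero[OF simple trace proj] p_nonzero by blast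
  ultimately show ?thesis by (simp add: p_idem p_star order_le_less)
qed

lemma trace_iso: "mat_trace \<tau> n (\<phi> x) = mat_trace \<tau> n p * \<tau> x"
proof -
  define t where "t = mat_trace \<tau> n p"
  have t: "0 < t" using trace_pos t_def by simp
  define \<sigma> where "\<sigma> x = mat_trace \<tau> n (\<phi> x) / t" for x
  have tadd: "\<tau> (a + b) = \<tau> a + \<tau> b" and tsc: "\<tau> (scaleC c a) = c * \<tau> a" for a b c
    using trace by (simp_all add: tracial_state_def)
  have "tracial_state \<sigma>"
    unfolding tracial_state_def
  proof (intro conjI allI)
    fix x y c
    show "\<sigma> (x + y) = \<sigma> x + \<sigma> y"
      unfolding \<sigma>_def add mat_trace_def add_divide_distrib[symmetric] sum.distrib[symmetric]
      by (intro arg_cong[of _ _ "\<lambda>s. s / t"] sum.cong refl)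
        (simp add: carrier_matD[OF carrier] tadd)
    show "\<sigma> (scaleC c x) = c * \<sigma> x"
      unfolding \<sigma>_def scaleC mat_trace_def times_divide_eq_right sum_distrib_left
      by (intro arg_cong[of _ _ "\<lambda>s. s / t"] sum.cong refl)
        (simp add: mat_scaleC_index[OF carrier] tsc)
    have "0 \<le> mat_trace \<tau> n (\<phi> (star x * x))"
      unfolding mult star by (rule mat_trace_star_mult_nonneg[OF trace carrier])
    moreover obtain r where "t = of_real r" "r > 0"
      using t by (metis complex_is_Real_iff less_complex_def of_real_Re zero_complex.sel)
    ultimately show "0 \<le> \<sigma> (star x * x)" by (simp add: \<sigma>_def less_eq_complex_def)
    show "\<sigma> 1 = 1" using t by (simp add: \<sigma>_def one t_def)
    show "\<sigma> (x * y) = \<sigma> (y * x)"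
      unfolding \<sigma>_def mult using mat_trace_commute[OF trace carrier carrier] by simp
  qed
  then have "\<sigma> = \<tau>" by (rule unique)
  then have "\<tau> x = mat_trace \<tau> n (\<phi> x) / t" by (simp add: \<sigma>_def fun_eq_iff)
  then show ?thesis using t by (simp add: t_def)
qed

text \<open>The diagonal blocks of \<open>amp x\<close> are the images of the diagonal entries of
  \<open>x\<close>, and \<open>trace_iso\<close> scales the trace of each.\<close>

lemma trace_amp:
  assumes x: "x \<in> carrier_mat m m"
  shows "mat_trace \<tau> (m * n) (amp x) = mat_trace \<tau> n p * mat_trace \<tau> m x"
proof -
  have "mat_trace \<tau> (m * n) (amp x)
      = (\<Sum>e<m * n. \<tau> (\<phi> (x $$ (e div n, e div n)) $$ (e mod n, e mod n)))"
    unfolding mat_trace_def by (intro sum.cong refl) (simp add: amp_index[OF x])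
  also have "\<dots> = (\<Sum>c<m. mat_trace \<tau> n (\<phi> (x $$ (c, c))))"
    unfolding mat_trace_def by (rule sum_div_mod)
  also have "\<dots> = mat_trace \<tau> n p * mat_trace \<tau> m x"
    unfolding trace_iso by (simp add: mat_trace_def[of \<tau> m] sum_distrib_left)
  finally show ?thesis .
qed

end

section \<open>Inverses\<close>

context unique_trace_corner
begin

text \<open>The right Hilbert module p A^n, with \<open>ip\<close> as its A-valued inner product.
  Vectors are functions on all of \<open>nat\<close> of which only the values below \<open>n\<close>
  count.\<close>

definition module_vecs :: "(nat \<Rightarrow> 'a) set" where
  "module_vecs = {w. \<forall>i<n. (\<Sum>j<n. p $$ (i, j) * w j) = w i}"

definition ip :: "(nat \<Rightarrow> 'a) \<Rightarrow> (nat \<Rightarrow> 'a) \<Rightarrow> 'a" where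
  "ip b c = (\<Sum>i<n. star (b i) * c i)"

lemma module_vecs_add: "b \<in> module_vecs \<Longrightarrow> c \<in> module_vecs \<Longrightarrow> (\<lambda>i. b i + c i) \<in> module_vecs"
  by (simp add: module_vecs_def distrib_left sum.distrib)

lemma module_vecs_mult: "b \<in> module_vecs \<Longrightarrow> (\<lambda>i. b i * a) \<in> module_vecs"
  by (simp add: module_vecs_def mult.assoc[symmetric] sum_distrib_right[symmetric])

lemma ip_mult_left: "ip (\<lambda>i. b i * a) c = star a * ip b c"
  by (simp add: ip_def star_mult sum_distrib_left mult.assoc)

lemma ip_mult_right: "ip b (\<lambda>i. c i * a) = ip b c * a"
  by (simp add: ip_def sum_distrib_right mult.assoc)

lemma star_ip: "star (ip b c) = ip c b"
  by (simp add: ip_def star_sum star_mult star_star)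

lemma ip_add_add: "ip (\<lambda>i. b i + c i) (\<lambda>i. b i + c i) = ip b b + ip c c + ip b c + ip c b"
  by (simp add: ip_def star_add distrib_left distrib_right sum.distrib)

lemma cstar_pos_ip: "cstar_pos (ip b b)"
  unfolding ip_def by (intro cstar_pos_sum cstar_pos_star_mult_self[OF simple trace])

text \<open>Finite sums of inner products form a two-sided ideal, since a factor \<open>a\<close>
  can be moved into either vector; the ideal is nonzero because \<open>p\<close> is.\<close>

lemma projection_full:
  "\<exists>L. set L \<subseteq> module_vecs \<times> module_vecs \<and> (\<Sum>(b, c)\<leftarrow>L. ip b c) = 1"
proof -
  define J where "J = {(\<Sum>(b, c)\<leftarrow>L. ip b c) | L. set L \<subseteq> module_vecs \<times> module_vecs}"
  obtain i j where ij: "i < n" "j < n" "p $$ (i, j) \<noteq> 0"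
  proof -
    have "\<not> (\<forall>i<n. \<forall>j<n. p $$ (i, j) = 0)"
    proof
      assume "\<forall>i<n. \<forall>j<n. p $$ (i, j) = 0"
      then have "p = 0\<^sub>m n n"
        using carrier_matD[OF p_carrier] by (intro eq_matI) auto
      then show False using p_nonzero by contradiction
    qed
    then show thesis using that by blast
  qed
  \<comment> \<open>Column \<open>j\<close> of \<open>p\<close> lies in the module because
    \<open>p * p = p\<close>, and its entry at \<open>i\<close> is nonzero.\<close>
  define w where "w = (\<lambda>i. p $$ (i, j))"
  have "w \<in> module_vecs"
    unfolding module_vecs_def w_def mem_Collect_eq
  proof (intro allI impI)
    fix l assume "l < n"
    then show "(\<Sum>k<n. p $$ (l, k) * p $$ (k, j)) = p $$ (l, j)"
      using mult_mat_index[OF p_carrier p_carrier _ ij(2), of l] by (simp add: p_idem)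
  qed
  then have "ip w w \<in> J"
    unfolding J_def by (intro CollectI exI[of _ "[(w, w)]"]) simp
  moreover have "ip w w \<noteq> 0"
  proof
    assume "ip w w = 0"
    then have "(\<Sum>i<n. \<tau> (star (w i) * w i)) = 0"
      using tracial_state_sum[OF trace] tracial_state_0[OF trace] unfolding ip_def by metis
    moreover have "0 \<le> \<tau> (star x * x)" for x using trace unfolding tracial_state_def by blast
    ultimately have "\<tau> (star (w i) * w i) = 0"
      using ij(1) by (simp add: sum_nonneg_eq_0_iff)
    then show False using tracial_state_faithful[OF simple trace] ij(3) unfolding w_def by blast
  qed
  moreover have "x + y \<in> J" if xy: "x \<in> J" "y \<in> J" for x y
  proof -
    obtain L L' where "set L \<subseteq> module_vecs \<times> module_vecs" "x = (\<Sum>(b, c)\<leftarrow>L. ip b c)"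
      "set L' \<subseteq> module_vecs \<times> module_vecs" "y = (\<Sum>(b, c)\<leftarrow>L'. ip b c)"
      using xy unfolding J_def by blast
    then show ?thesis unfolding J_def by (intro CollectI exI[of _ "L @ L'"]) simp
  qed
  moreover have "a * x \<in> J" "x * a \<in> J" if x: "x \<in> J" for a x
  proof -
    obtain L where L: "set L \<subseteq> module_vecs \<times> module_vecs" "x = (\<Sum>(b, c)\<leftarrow>L. ip b c)"
      using x unfolding J_def by blast
    \<comment> \<open>The inner product is conjugate linear in its first argument, hence
      \<open>star a\<close>.\<close>
    have "a * x = (\<Sum>(b, c)\<leftarrow>map (\<lambda>(b, c). (\<lambda>i. b i * star a, c)) L. ip b c)"
      unfolding L(2) sum_list_const_mult[symmetric]
      by (simp add: o_def case_prod_beta ip_mult_left star_star)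
    moreover have "set (map (\<lambda>(b, c). (\<lambda>i. b i * star a, c)) L) \<subseteq> module_vecs \<times> module_vecs"
      using L(1) by (auto intro: module_vecs_mult)
    ultimately show "a * x \<in> J" unfolding J_def by blast
    have "x * a = (\<Sum>(b, c)\<leftarrow>map (\<lambda>(b, c). (b, \<lambda>i. c i * a)) L. ip b c)"
      unfolding L(2) sum_list_mult_const[symmetric]
      by (simp add: o_def case_prod_beta ip_mult_right)
    moreover have "set (map (\<lambda>(b, c). (b, \<lambda>i. c i * a)) L) \<subseteq> module_vecs \<times> module_vecs"
      using L(1) by (auto intro: module_vecs_mult)
    ultimately show "x * a \<in> J" unfolding J_def by blast
  qed
  ultimately have "1 \<in> J" by (intro simple_ideal_contains_one[OF simple])
  then obtain L where "set L \<subseteq> module_vecs \<times> module_vecs" "1 = (\<Sum>(b, c)\<leftarrow>L. ip b c)"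
    unfolding J_def by blast
  then show ?thesis by (intro exI[of _ L]) simp
qed

text \<open>
  If \<open>\<Sum> \<langle>b, c\<rangle> = 1\<close> then \<open>\<Sum> \<langle>b + c, b + c\<rangle> = 2 + \<Sum> (\<langle>b, b\<rangle> + \<langle>c, c\<rangle>)\<close>, which is positive and
  invertible, hence can be normalised to \<open>1\<close>.
\<close>

lemma ex_normalized_vecs:
  "\<exists>ws. set ws \<subseteq> module_vecs \<and> (\<Sum>w\<leftarrow>ws. ip w w) = 1"
proof -
  obtain L where L: "set L \<subseteq> module_vecs \<times> module_vecs" "(\<Sum>(b, c)\<leftarrow>L. ip b c) = 1"
    using projection_full by blast
  have L': "(\<Sum>(b, c)\<leftarrow>L. ip c b) = 1"
    using arg_cong[OF L(2), of star] by (simp add: star_sum_list o_def case_prod_beta' star_ip)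
  define D where "D = (\<Sum>(b, c)\<leftarrow>L. ip b b + ip c c)"
  have "cstar_pos D"
    unfolding D_def
    by (induction L) (auto simp: cstar_pos_0 intro!: cstar_pos_add cstar_pos_ip)
  \<comment> \<open>The inverse root is available for \<open>1\<close> plus a positive element, so
    \<open>2 + D\<close> is read as \<open>1 + (1 + D)\<close>.\<close>
  moreover have "cstar_pos (1 :: 'a)"
    using cstar_pos_star_mult_self[OF simple trace, of 1] by simp
  ultimately obtain s where s: "star s * (1 + (1 + D)) * s = 1"
    using cstar_pos_inverse_sqrt cstar_pos_add by blast
  have "(\<Sum>(b, c)\<leftarrow>L. ip (\<lambda>i. b i + c i) (\<lambda>i. b i + c i))
      = D + (\<Sum>(b, c)\<leftarrow>L. ip b c) + (\<Sum>(b, c)\<leftarrow>L. ip c b)"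
    unfolding D_def ip_add_add by (induction L) (auto simp: add_ac)
  also have "\<dots> = 1 + (1 + D)" unfolding L(2) L' by (simp add: add_ac)
  finally have S: "(\<Sum>(b, c)\<leftarrow>L. ip (\<lambda>i. b i + c i) (\<lambda>i. b i + c i)) = 1 + (1 + D)" .
  define ws where "ws = map (\<lambda>(b, c). \<lambda>i. (b i + c i) * s) L"
  have "(\<Sum>w\<leftarrow>ws. ip w w) = (\<Sum>(b, c)\<leftarrow>L. star s * ip (\<lambda>i. b i + c i) (\<lambda>i. b i + c i) * s)"
    unfolding ws_def
    by (simp add: o_def case_prod_beta' ip_mult_left ip_mult_right mult.assoc)
  also have "\<dots> = star s * (1 + (1 + D)) * s"
    unfolding S[symmetric] by (induction L) (auto simp: distrib_left distrib_right)
  finally have "(\<Sum>w\<leftarrow>ws. ip w w) = 1" using s by simp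
  moreover have "set ws \<subseteq> module_vecs"
    using L(1) unfolding ws_def by (auto intro!: module_vecs_mult module_vecs_add)
  ultimately show ?thesis by blast
qed

text \<open>The normalised vectors are stacked into one column \<open>v\<close> of \<open>m\<close>
  blocks of length \<open>n\<close>. The clauses then say that \<open>v\<close> is isometric and
  that diag(p, ..., p) fixes it.\<close>

lemma ex_isometry:
  "\<exists>m v. (\<Sum>i<m * n. star (v i) * v i) = 1
    \<and> (\<forall>i<m * n. (\<Sum>d<n. p $$ (i mod n, d) * v (i div n * n + d)) = v i)"
proof -
  obtain ws where ws: "set ws \<subseteq> module_vecs" "(\<Sum>w\<leftarrow>ws. ip w w) = 1"
    using ex_normalized_vecs by blast
  define v where "v i = (ws ! (i div n)) (i mod n)" for i
  have "(\<Sum>i<length ws * n. star (v i) * v i) = (\<Sum>c<length ws. ip (ws ! c) (ws ! c))"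
    unfolding v_def ip_def by (rule sum_div_mod)
  also have "\<dots> = 1"
    using ws(2) by (simp add: sum_list_sum_nth atLeast0LessThan)
  finally have "(\<Sum>i<length ws * n. star (v i) * v i) = 1" .
  moreover have "(\<Sum>d<n. p $$ (i mod n, d) * v (i div n * n + d)) = v i" if "i < length ws * n" for i
  proof -
    note d = div_mod_less[OF that]
    then have "ws ! (i div n) \<in> module_vecs" using ws(1) by auto
    then have "(\<Sum>d<n. p $$ (i mod n, d) * (ws ! (i div n)) d) = v i"
      using d unfolding module_vecs_def v_def by blast
    moreover have "v (i div n * n + d) = (ws ! (i div n)) d" if "d < n" for d
      using that by (simp add: v_def)
    ultimately show ?thesis by simp
  qed
  ultimately show ?thesis by blast
qed

lemma ex_inverse_corner:
  "\<exists>m q \<psi>. corner_isomorphism m q \<psi> \<and> mat_trace \<tau> n p * mat_trace \<tau> m q = 1"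
proof -
  obtain m v where v1: "(\<Sum>i<m * n. star (v i) * v i) = 1"
    and v2: "\<And>i. i < m * n \<Longrightarrow> (\<Sum>d<n. p $$ (i mod n, d) * v (i div n * n + d)) = v i"
    using ex_isometry by blast
  define N where "N = m * n"
  \<comment> \<open>With \<open>v\<close> as a column, \<open>F a\<close> is
    \<open>v a star(v)\<close>; in particular \<open>F 1\<close> is the projection
    \<open>v star(v)\<close>.\<close>
  define F where "F a = Matrix.mat N N (\<lambda>(i, j). v i * a * star (v j))" for a
  have Fc [simp]: "F a \<in> carrier_mat N N" for a by (simp add: F_def)
  have Fi: "F a $$ (i, j) = v i * a * star (v j)" if "i < N" "j < N" for a i j
    using that by (simp add: F_def)
  \<comment> \<open>This puts the corner of \<open>F 1\<close> inside the range of \<open>F\<close>: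
    compressing \<open>X\<close> gives \<open>F\<close> of the element \<open>star(v) X v\<close> of
    A.\<close>
  have Fsandwich: "F 1 * X * F 1 = F (\<Sum>l<N. (\<Sum>k<N. star (v k) * X $$ (k, l)) * v l)"
    if X: "X \<in> carrier_mat N N" for X
  proof (rule eq_matI, goal_cases)
    case (1 i j)
    then have ij: "i < N" "j < N" by (simp_all add: F_def)
    have FX: "F 1 * X \<in> carrier_mat N N" using X by simp
    have "(F 1 * X * F 1) $$ (i, j) = (\<Sum>l<N. (\<Sum>k<N. v i * star (v k) * X $$ (k, l)) * (v l * star (v j)))"
      using ij by (simp add: mult_mat_index[OF FX Fc] mult_mat_index[OF Fc X] Fi del: index_mult_mat)
    then show ?case using ij by (simp add: Fi sum_distrib_left sum_distrib_right mult.assoc)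
  qed (use X in \<open>simp_all add: F_def\<close>)
  have Fmult: "F a * F b = F (a * b)" for a b
  proof (rule eq_matI, goal_cases)
    case (1 i j)
    then have ij: "i < N" "j < N" by (simp_all add: F_def)
    have "(F a * F b) $$ (i, j) = (\<Sum>l<N. v i * a * (star (v l) * v l) * (b * star (v j)))"
      using ij by (simp add: mult_mat_index[OF Fc Fc] Fi mult.assoc del: index_mult_mat)
    also have "\<dots> = v i * a * (\<Sum>l<N. star (v l) * v l) * (b * star (v j))"
      by (simp only: sum_distrib_left sum_distrib_right)
    finally show ?case using ij v1 by (simp add: Fi N_def mult.assoc)
  qed (simp_all add: F_def)
  have Fstar: "mat_star (F a) = F (star a)" for a
    by (rule eq_matI) (auto simp: F_def mat_star_def star_mult star_star mult.assoc)
  have Fadd: "F (a + b) = F a + F b" for a b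
    by (rule eq_matI) (auto simp: F_def distrib_left distrib_right)
  have FscaleC: "F (scaleC c a) = mat_scaleC c (F a)" for c a
    by (rule eq_matI) (auto simp: F_def mat_scaleC_def mult_scaleC_left mult_scaleC_right)
  have Finj: "a = b" if "F a = F b" for a b
  proof -
    \<comment> \<open>The left inverse of \<open>F\<close>: sandwiching \<open>F a\<close> between
      \<open>star(v)\<close> and \<open>v\<close> recovers \<open>a\<close>, as
      \<open>star(v) v = 1\<close>.\<close>
    have "(\<Sum>l<N. (\<Sum>k<N. star (v k) * F a $$ (k, l)) * v l) = a" for a
    proof -
      have "(\<Sum>l<N. (\<Sum>k<N. star (v k) * F a $$ (k, l)) * v l)
        = (\<Sum>l<N. (\<Sum>k<N. star (v k) * v k) * (a * (star (v l) * v l)))"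
        by (intro sum.cong refl) (simp add: Fi sum_distrib_right mult.assoc)
      also have "\<dots> = a"
        using v1 by (simp add: N_def sum_distrib_left[symmetric])
      finally show ?thesis .
    qed
    from this[of a, unfolded that] this[of b] show ?thesis by (rule trans[OF sym])
  qed
  \<comment> \<open>Together with its adjoint \<open>FP\<close>, this places \<open>F a\<close>
    under diag(p, ..., p), hence in the image of \<open>amp\<close>.\<close>
  have PF: "unit_amp m * F a = F a" for a
  proof (rule eq_matI, goal_cases)
    case (1 i j)
    then have ij: "i < N" "j < N" by (simp_all add: F_def)
    have l: "i div n * n + d < N" if "d < n" for d
      using div_mod_less[of i m n] ij that unfolding N_def by (simp add: block_index_less)
    have "(unit_amp m * F a) $$ (i, j)
      = (\<Sum>d<n. p $$ (i mod n, d) * v (i div n * n + d) * (a * star (v j)))"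
      using unit_amp_mult_index[of "F a" m N i j] ij l unfolding N_def[symmetric]
      by (simp add: Fi mult.assoc del: index_mult_mat)
    also have "\<dots> = (\<Sum>d<n. p $$ (i mod n, d) * v (i div n * n + d)) * (a * star (v j))"
      by (simp only: sum_distrib_right)
    finally show ?case using ij v2[of i] by (simp add: Fi N_def mult.assoc)
  qed (auto simp: F_def amp_def N_def)
  have Pc: "unit_amp m \<in> carrier_mat N N" unfolding N_def by auto
  have FP: "F a * unit_amp m = F a" for a
  proof -
    have "mat_star (unit_amp m * F (star a)) = mat_star (F (star a))" by (simp only: PF)
    then show ?thesis
      using amp_star[of "1\<^sub>m m" m m]
      by (simp add: mat_star_mult[OF Pc Fc] Fstar star_star mat_star_one)
  qed
  have "\<exists>y\<in>carrier_mat m m. amp y = F a" for a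
    using amp_surj[of "F a" m] PF FP Fc unfolding N_def by simp
  then obtain \<psi> where \<psi>c [simp]: "\<And>a. \<psi> a \<in> carrier_mat m m" and \<psi>: "\<And>a. amp (\<psi> a) = F a"
    by metis
  \<comment> \<open>Injectivity of \<open>amp\<close> transfers the algebraic identities for
    \<open>F\<close> to \<open>\<psi>\<close>.\<close>
  have \<psi>eq: "y = \<psi> a" if "y \<in> carrier_mat m m" "amp y = F a" for y a
    using amp_inj[OF that(1) \<psi>c] that(2) \<psi> by simp
  have \<psi>mult: "\<psi> a * \<psi> b = \<psi> (a * b)" for a b
    by (rule \<psi>eq) (simp_all add: amp_mult[OF \<psi>c \<psi>c] \<psi> Fmult)
  have \<psi>star: "mat_star (\<psi> a) = \<psi> (star a)" for a
    by (rule \<psi>eq) (simp_all add: amp_star[OF \<psi>c] \<psi> Fstar)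
  have \<psi>add: "\<psi> a + \<psi> b = \<psi> (a + b)" for a b
    by (rule \<psi>eq) (simp_all add: amp_add[OF \<psi>c \<psi>c] \<psi> Fadd)
  have \<psi>scaleC: "mat_scaleC c (\<psi> a) = \<psi> (scaleC c a)" for c a
    by (rule \<psi>eq) (simp_all add: amp_scaleC[OF \<psi>c] \<psi> FscaleC)
  define q where "q = \<psi> 1"
  have q: "mat_projection m q"
    by (simp add: mat_projection_def q_def \<psi>mult \<psi>star)
  have "inj \<psi>" by (rule injI, rule Finj) (metis \<psi>)
  moreover have "range \<psi> = corner m q"
  proof (intro subset_antisym subsetI)
    fix X assume "X \<in> range \<psi>"
    then obtain a where "X = \<psi> a" by blast
    then have "X = q * X * q" by (simp add: q_def \<psi>mult)
    then show "X \<in> corner m q" unfolding corner_def using \<open>X = \<psi> a\<close> \<psi>c by blast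
  next
    fix X assume "X \<in> corner m q"
    then obtain x where x: "x \<in> carrier_mat m m" "X = q * x * q" unfolding corner_def by blast
    have aX: "amp X = F 1 * amp x * F 1"
      using x by (simp add: amp_mult[of _ m m _ m] q_def \<psi> del: assoc_mult_mat)
    have "amp x \<in> carrier_mat N N" using x(1) unfolding N_def by blast
    note Fsandwich[OF this, folded aX]
    moreover have "X \<in> carrier_mat m m" using x by (simp add: q_def)
    ultimately have "X = \<psi> (\<Sum>l<N. (\<Sum>k<N. star (v k) * amp x $$ (k, l)) * v l)"
      by (intro \<psi>eq)
    then show "X \<in> range \<psi>" by (rule range_eqI)
  qed
  ultimately have "corner_isomorphism m q \<psi>"
    using q by (simp add: corner_isomorphism_def star_isomorphism_onto_def bij_betw_def
        \<psi>mult \<psi>star \<psi>add \<psi>scaleC)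
  moreover have "mat_trace \<tau> n p * mat_trace \<tau> m q = 1"
  proof -
    have comm: "\<tau> (a * b) = \<tau> (b * a)" for a b using trace unfolding tracial_state_def by blast
    have "mat_trace \<tau> n p * mat_trace \<tau> m q = mat_trace \<tau> N (F 1)"
      using trace_amp[of q m] by (simp add: q_def \<psi> N_def)
    also have "\<dots> = (\<Sum>i<N. \<tau> (star (v i) * v i))"
      unfolding mat_trace_def by (intro sum.cong refl) (simp add: Fi comm[of "v _"])
    also have "\<dots> = \<tau> 1"
      using v1 by (simp add: tracial_state_sum[OF trace, symmetric] N_def)
    also have "\<dots> = 1" using trace by (simp add: tracial_state_def)
    finally show ?thesis .
  qed
  ultimately show ?thesis by blast
qed

end

section \<open>Traces of close projections\<close>

text \<open>An entry of the next power is a sum of \<open>n\<close> products, so the bound is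
  multiplied by at most \<open>n / (2 * (n + 1))\<close>, which is below 1/2.\<close>

lemma mat_pow_entry_le:
  fixes b :: "'a::real_normed_algebra_1 mat"
  assumes b: "b \<in> carrier_mat n n"
    and le: "\<And>i j. i < n \<Longrightarrow> j < n \<Longrightarrow> norm (b $$ (i, j)) \<le> 1 / (2 * (real n + 1))"
  shows "i < n \<Longrightarrow> j < n \<Longrightarrow> norm ((b ^\<^sub>m k) $$ (i, j)) \<le> (1 / 2) ^ k"
proof (induction k arbitrary: i j)
  case (Suc k)
  have c: "b ^\<^sub>m k \<in> carrier_mat n n" using b by simp
  have "norm ((b ^\<^sub>m Suc k) $$ (i, j)) = norm (\<Sum>l<n. (b ^\<^sub>m k) $$ (i, l) * b $$ (l, j))"
    using Suc.prems by (simp add: mult_mat_index[OF c b] del: index_mult_mat)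
  also have "\<dots> \<le> (\<Sum>l<n. (1 / 2) ^ k * (1 / (2 * (real n + 1))))"
    using Suc by (intro sum_norm_le order_trans[OF norm_mult_ineq] mult_mono le) auto
  also have "\<dots> = (1 / 2) ^ Suc k * (real n / (real n + 1))"
    by (simp add: field_simps)
  also have "\<dots> \<le> (1 / 2) ^ Suc k * 1" by (intro mult_left_mono) auto
  finally show ?case by simp
qed (use b in \<open>auto simp: one_mat_def\<close>)

text \<open>The Neumann series of \<open>b\<close>, summed separately in each entry and dominated by
  the geometric series of ratio 1/2.\<close>

lemma mat_near_one_invertible:
  fixes b :: "'a::{real_normed_algebra_1,banach} mat"
  assumes b: "b \<in> carrier_mat n n"
    and le: "\<And>i j. i < n \<Longrightarrow> j < n \<Longrightarrow> norm (b $$ (i, j)) \<le> 1 / (2 * (real n + 1))"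
  shows "\<exists>y\<in>carrier_mat n n. (1\<^sub>m n - b) * y = 1\<^sub>m n \<and> y * (1\<^sub>m n - b) = 1\<^sub>m n"
proof -
  have c: "b ^\<^sub>m k \<in> carrier_mat n n" for k using b by simp
  have s: "summable (\<lambda>k. (b ^\<^sub>m k) $$ (i, j))" if "i < n" "j < n" for i j
    by (rule summable_comparison_test[OF _ summable_geometric[of "1 / 2 :: real"]])
      (use mat_pow_entry_le[OF b le] that in auto)
  define y where "y = Matrix.mat n n (\<lambda>(i, j). \<Sum>k. (b ^\<^sub>m k) $$ (i, j))"
  have y: "y \<in> carrier_mat n n" by (simp add: y_def)
  have y_index: "y $$ (i, j) = (\<Sum>k. (b ^\<^sub>m k) $$ (i, j))" if "i < n" "j < n" for i j
    using that by (simp add: y_def)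
  have shift: "(\<Sum>k. (b ^\<^sub>m Suc k) $$ (i, j)) = y $$ (i, j) - 1\<^sub>m n $$ (i, j)" if "i < n" "j < n" for i j
    using suminf_split_head[OF s[OF that]] that b by (simp add: y_index)
  \<comment> \<open>Matrix powers grow by multiplication on the right; the computation of
    \<open>b * y\<close> needs the factor on the left.\<close>
  have comm: "b * b ^\<^sub>m k = b ^\<^sub>m Suc k" for k
  proof (induction k)
    case (Suc k)
    have "b * b ^\<^sub>m Suc k = (b * b ^\<^sub>m k) * b"
      using b c[of k] by (simp add: assoc_mult_mat[of _ n n _ n _ n])
    then show ?case using Suc by simp
  qed (use b in simp)
  have "b * y = y - 1\<^sub>m n"
  proof (rule eq_matI, goal_cases)
    case (1 i j)
    then have ij: "i < n" "j < n" by auto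
    have "(b * y) $$ (i, j) = (\<Sum>l<n. \<Sum>k. b $$ (i, l) * (b ^\<^sub>m k) $$ (l, j))"
      using ij by (simp add: mult_mat_index[OF b y] y_index s suminf_mult del: index_mult_mat)
    also have "\<dots> = (\<Sum>k. \<Sum>l<n. b $$ (i, l) * (b ^\<^sub>m k) $$ (l, j))"
      using ij by (intro suminf_sum[symmetric] summable_mult s) auto
    also have "\<dots> = (\<Sum>k. (b ^\<^sub>m Suc k) $$ (i, j))"
      using ij by (simp only: comm[symmetric] mult_mat_index[OF b c])
    finally show ?case using ij y shift by simp
  qed (use b y in auto)
  moreover have "y * b = y - 1\<^sub>m n"
  proof (rule eq_matI, goal_cases)
    case (1 i j)
    then have ij: "i < n" "j < n" by auto
    have "(y * b) $$ (i, j) = (\<Sum>l<n. \<Sum>k. (b ^\<^sub>m k) $$ (i, l) * b $$ (l, j))"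
      using ij by (simp add: mult_mat_index[OF y b] y_index s suminf_mult2 del: index_mult_mat)
    also have "\<dots> = (\<Sum>k. \<Sum>l<n. (b ^\<^sub>m k) $$ (i, l) * b $$ (l, j))"
      using ij by (intro suminf_sum[symmetric] summable_mult2 s) auto
    also have "\<dots> = (\<Sum>k. (b ^\<^sub>m Suc k) $$ (i, j))"
      using ij by (simp only: pow_mat.simps mult_mat_index[OF c b])
    finally show ?case using ij y shift by simp
  qed (use b y in auto)
  moreover have "y - (y - 1\<^sub>m n) = 1\<^sub>m n" using y by (intro eq_matI) auto
  ultimately have "(1\<^sub>m n - b) * y = 1\<^sub>m n" "y * (1\<^sub>m n - b) = 1\<^sub>m n"
    using b y minus_mult_distrib_mat[OF one_carrier_mat b y]
      mult_minus_distrib_mat[OF y one_carrier_mat b] by simp_all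
  then show ?thesis using y by blast
qed

text \<open>For nearby projections, \<open>z = p q + (1 - p) (1 - q)\<close> is invertible and \<open>p z = z q\<close>.\<close>

lemma mat_trace_close_projections:
  fixes p q :: "'a::unital_cstar_algebra mat"
  assumes tr: "tracial_state \<tau>" and "mat_projection n p" "mat_projection n q" and M: "M \<ge> 0"
    and pM: "\<And>i j. i < n \<Longrightarrow> j < n \<Longrightarrow> norm (p $$ (i, j)) \<le> M"
    and qM: "\<And>i j. i < n \<Longrightarrow> j < n \<Longrightarrow> norm (q $$ (i, j)) \<le> M"
    and close: "\<And>i j. i < n \<Longrightarrow> j < n \<Longrightarrow>
      norm (p $$ (i, j) - q $$ (i, j)) \<le> 1 / (4 * (real n + 1)\<^sup>2 * (M + 1))"
  shows "mat_trace \<tau> n p = mat_trace \<tau> n q"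
proof -
  have p: "p \<in> carrier_mat n n" "p * p = p" and q: "q \<in> carrier_mat n n" "q * q = q"
    using assms(2,3) by (auto simp: mat_projection_def)
  have pq: "p * q \<in> carrier_mat n n" using p q by simp
  \<comment> \<open>The entries of \<open>b\<close> will be bounded by
    \<open>2 n M \<epsilon>\<close>, which has to be at most \<open>1 / (2 (n + 1))\<close>. Solving
    with \<open>n + 1\<close> and \<open>M + 1\<close> for \<open>n\<close> and \<open>M\<close>
    gives this constant and keeps the denominator nonzero.\<close>
  define \<epsilon> where "\<epsilon> = 1 / (4 * (real n + 1)\<^sup>2 * (M + 1))"
  \<comment> \<open>Expanding \<open>z\<close> gives \<open>1 - b\<close>. Moreover
    \<open>b = p (p - q) + (q - p) q\<close>, which is small when \<open>p\<close> and
    \<open>q\<close> are close.\<close>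
  define b where "b = (p - p * q) + (q - p * q)"
  have b: "b \<in> carrier_mat n n" using p q pq by (auto simp: b_def)
  have "norm (b $$ (i, j)) \<le> 1 / (2 * (real n + 1))" if ij: "i < n" "j < n" for i j
  proof -
    have "p $$ (i, j) = (\<Sum>l<n. p $$ (i, l) * p $$ (l, j))"
      using mult_mat_index[OF p(1) p(1) ij] p by simp
    moreover have "q $$ (i, j) = (\<Sum>l<n. q $$ (i, l) * q $$ (l, j))"
      using mult_mat_index[OF q(1) q(1) ij] q by simp
    moreover have "b $$ (i, j) = (p $$ (i, j) - (p * q) $$ (i, j)) + (q $$ (i, j) - (p * q) $$ (i, j))"
      using p q pq ij by (simp add: b_def del: index_mult_mat(1))
    ultimately have "b $$ (i, j) = (\<Sum>l<n. p $$ (i, l) * (p $$ (l, j) - q $$ (l, j))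
        + (q $$ (i, l) - p $$ (i, l)) * q $$ (l, j))"
      by (simp add: mult_mat_index[OF p(1) q(1) ij] sum_subtractf sum.distrib algebra_simps)
    also have "norm \<dots> \<le> (\<Sum>l<n. M * \<epsilon> + \<epsilon> * M)"
    proof (intro sum_norm_le norm_triangle_mono order_trans[OF norm_mult_ineq] mult_mono)
      fix l assume "l \<in> {..<n}"
      then have "l < n" by simp
      then show "norm (p $$ (i, l)) \<le> M" "norm (q $$ (l, j)) \<le> M"
        "norm (p $$ (l, j) - q $$ (l, j)) \<le> \<epsilon>" "norm (q $$ (i, l) - p $$ (i, l)) \<le> \<epsilon>"
        using pM qM close ij unfolding \<epsilon>_def by (auto simp: norm_minus_commute)
    qed (use M in \<open>auto simp: \<epsilon>_def\<close>)
    also have "\<dots> = (real n * M) * (2 * \<epsilon>)" by simp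
    also have "\<dots> \<le> ((real n + 1) * (M + 1)) * (2 * \<epsilon>)"
      using M by (intro mult_right_mono mult_mono) (auto simp: \<epsilon>_def)
    also have "\<dots> = 1 / (2 * (real n + 1))"
    proof -
      have "M + 1 \<noteq> 0" "real n + 1 \<noteq> 0" using M by auto
      then show ?thesis by (simp add: \<epsilon>_def power2_eq_square divide_simps)
    qed
    finally show ?thesis .
  qed
  then obtain y where y: "y \<in> carrier_mat n n"
      "(1\<^sub>m n - b) * y = 1\<^sub>m n" "y * (1\<^sub>m n - b) = 1\<^sub>m n"
    using mat_near_one_invertible[OF b] by blast
  define z where "z = 1\<^sub>m n - b"
  have z: "z \<in> carrier_mat n n" using b by (auto simp: z_def)
  have ppq: "p * (p * q) = p * q"
    using assoc_mult_mat[OF p(1) p(1) q(1)] p(2) by simp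
  have pqq: "p * q * q = p * q"
    using assoc_mult_mat[OF p(1) q(1) q(1)] q(2) by simp
  have d: "p - p * q \<in> carrier_mat n n" "q - p * q \<in> carrier_mat n n" using p q pq by auto
  have "p * z = p - ((p * p - p * (p * q)) + (p * q - p * (p * q)))"
    unfolding z_def b_def using p q pq d
    by (simp add: mult_minus_distrib_mat[of _ n n _ n] mult_add_distrib_mat[of _ n n _ n]
        del: assoc_mult_mat)
  also have "\<dots> = p * q"
    unfolding ppq p(2) using p(1) q(1) pq by (intro eq_matI) (auto simp del: index_mult_mat(1))
  finally have pz: "p * z = p * q" .
  have "z * q = q - ((p * q - p * q * q) + (q * q - p * q * q))"
    unfolding z_def b_def using p q pq d
    by (simp add: minus_mult_distrib_mat[of _ n n _ _ n] add_mult_distrib_mat[of _ n n _ _ n]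
        del: assoc_mult_mat)
  also have "\<dots> = p * q"
    unfolding pqq q(2) using p(1) q(1) pq by (intro eq_matI) (auto simp del: index_mult_mat(1))
  finally have zq: "z * q = p * q" .
  have qy: "q * y \<in> carrier_mat n n" using q y by simp
  have "p = p * (z * y)" using y p by (simp add: z_def)
  also have "\<dots> = z * (q * y)"
    using assoc_mult_mat[OF p(1) z y(1)] assoc_mult_mat[OF z q(1) y(1)] pz zq by metis
  finally have "mat_trace \<tau> n p = mat_trace \<tau> n (q * y * z)"
    using mat_trace_commute[OF tr z qy] by simp
  also have "q * y * z = q * (y * z)" using q y z by (simp add: assoc_mult_mat[of _ n n _ n _ n])
  also have "\<dots> = q" using y q by (simp add: z_def)
  finally show ?thesis .
qed

text \<open>A code \<open>(n, M, ds)\<close>, consisting of a size, an entry bound and a list of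
  approximate entries from a countable dense set, determines at most one trace, because projections
  with the same code are close. The bound is part of the code since the closeness required depends
  on it.\<close>

lemma countable_projection_traces:
  fixes \<tau> :: "'a::unital_cstar_algebra \<Rightarrow> complex"
  assumes tr: "tracial_state \<tau>" and sep: "separable_space (euclidean :: 'a topology)"
  shows "countable {mat_trace \<tau> n p | n p. mat_projection n p}"
proof -
  obtain D :: "'a set" where D: "countable D" "closure D = UNIV"
    using sep by (auto simp: separable_space_def)
  \<comment> \<open>Half of the distance allowed in \<open>mat_trace_close_projections\<close>, as
    two projections are compared through a common list.\<close>
  define \<delta> where "\<delta> n M = 1 / (8 * (real n + 1)\<^sup>2 * (real M + 1))" for n M :: nat
  have \<delta>: "\<delta> n M > 0" for n M by (simp add: \<delta>_def)
  \<comment> \<open>The list holds a matrix row by row. If it is too short, some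
    \<open>ds ! k\<close> are unspecified, but they are the same for both projections being
    compared.\<close>
  define near where "near n M ds p \<longleftrightarrow> mat_projection n p \<and> (\<forall>i<n. \<forall>j<n.
    norm (p $$ (i, j)) \<le> real M \<and> norm (p $$ (i, j) - ds ! (i * n + j)) < \<delta> n M)"
    for n M and ds :: "'a list" and p
  define T where "T = (\<lambda>(n, M, ds). {mat_trace \<tau> n p | p. near n M ds p})"
  have "countable (T c)" for c
  proof -
    obtain n M ds where c: "c = (n, M, ds)" by (metis surj_pair)
    have "x = y" if xy: "x \<in> T c" "y \<in> T c" for x y
    proof -
      obtain p q where p: "near n M ds p" "x = mat_trace \<tau> n p" and q: "near n M ds q" "y = mat_trace \<tau> n q"
        using xy unfolding T_def c by auto
      have "norm (p $$ (i, j) - q $$ (i, j)) \<le> 1 / (4 * (real n + 1)\<^sup>2 * (real M + 1))"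
        if ij: "i < n" "j < n" for i j
      proof -
        have "norm (p $$ (i, j) - ds ! (i * n + j)) < \<delta> n M" "norm (q $$ (i, j) - ds ! (i * n + j)) < \<delta> n M"
          using p q ij unfolding near_def by blast+
        then have "norm (p $$ (i, j) - q $$ (i, j)) \<le> \<delta> n M + \<delta> n M"
          using norm_triangle_ineq4[of "p $$ (i, j) - ds ! (i * n + j)" "q $$ (i, j) - ds ! (i * n + j)"]
          by simp
        then show ?thesis by (simp add: \<delta>_def mult_ac)
      qed
      then show "x = y"
        unfolding p(2) q(2)
        by (intro mat_trace_close_projections[OF tr, of n p q "real M"])
          (use p(1) q(1) in \<open>auto simp: near_def\<close>)
    qed
    then have "\<exists>x. T c \<subseteq> {x}" by blast
    then show ?thesis by (metis countable_empty countable_insert countable_subset)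
  qed
  then have "countable (\<Union>c\<in>UNIV \<times> UNIV \<times> lists D. T c)"
    using D(1) by (intro countable_UN countable_SIGMA countable_lists) auto
  moreover have "{mat_trace \<tau> n p | n p. mat_projection n p} \<subseteq> (\<Union>c\<in>UNIV \<times> UNIV \<times> lists D. T c)"
  proof
    fix x assume "x \<in> {mat_trace \<tau> n p | n p. mat_projection n p}"
    then obtain n p where p: "mat_projection n p" "x = mat_trace \<tau> n p" by blast
    obtain M :: nat where M: "(\<Sum>i<n. \<Sum>j<n. norm (p $$ (i, j))) \<le> real M"
      using real_arch_simple by blast
    have pM: "norm (p $$ (i, j)) \<le> real M" if "i < n" "j < n" for i j
    proof -
      have "norm (p $$ (i, j)) \<le> (\<Sum>j<n. norm (p $$ (i, j)))"
        using that by (intro member_le_sum) auto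
      also have "\<dots> \<le> (\<Sum>i<n. \<Sum>j<n. norm (p $$ (i, j)))"
        using that by (intro member_le_sum[of i _ "\<lambda>i. \<Sum>j<n. norm (p $$ (i, j))"] sum_nonneg) auto
      finally show ?thesis using M by simp
    qed
    have "\<exists>d\<in>D. norm (a - d) < \<delta> n M" for a
      using D(2) closure_approachable[of a D] \<delta>[of n M]
      by (auto simp: dist_norm norm_minus_commute)
    then obtain g where g: "\<And>a. g a \<in> D" "\<And>a. norm (a - g a) < \<delta> n M" by metis
    define ds where "ds = map (\<lambda>e. g (p $$ (e div n, e mod n))) [0..<n * n]"
    have "ds ! (i * n + j) = g (p $$ (i, j))" if "i < n" "j < n" for i j
      using that block_index_less[OF that(1,2)] by (simp add: ds_def)
    then have "near n M ds p" unfolding near_def using p(1) pM g(2) by simp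
    moreover have "ds \<in> lists D" using g(1) by (auto simp: ds_def)
    ultimately show "x \<in> (\<Union>c\<in>UNIV \<times> UNIV \<times> lists D. T c)"
      unfolding p(2) T_def by (intro UN_I[of "(n, M, ds)"]) auto
  qed
  ultimately show ?thesis by (rule countable_subset[rotated])
qed

section \<open>The fundamental group\<close>

text \<open>Provides the unit of the group: A is M_1(A), and the projection \<open>1\<close> there
  has trace 1.\<close>

lemma corner_isomorphism_one:
  "corner_isomorphism 1 (1\<^sub>m 1) (\<lambda>a::'a::unital_cstar_algebra. Matrix.mat 1 1 (\<lambda>_. a))"
proof -
  let ?E = "\<lambda>a::'a. Matrix.mat 1 1 (\<lambda>_. a)"
  have "range ?E = carrier_mat 1 1"
  proof (intro subset_antisym subsetI)
    fix X :: "'a mat" assume "X \<in> carrier_mat 1 1"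
    then have "X = ?E (X $$ (0, 0))" by (intro eq_matI) auto
    then show "X \<in> range ?E" by (rule range_eqI)
  qed auto
  moreover have "corner 1 (1\<^sub>m 1 :: 'a mat) = carrier_mat 1 1"
  proof (intro subset_antisym subsetI)
    fix X :: "'a mat" assume "X \<in> carrier_mat 1 1"
    moreover from this have "X = 1\<^sub>m 1 * X * 1\<^sub>m 1" by simp
    ultimately show "X \<in> corner 1 (1\<^sub>m 1)" unfolding corner_def by blast
  qed (auto simp: corner_def)
  moreover have "inj ?E"
  proof (rule injI)
    fix x y assume "?E x = ?E y"
    from arg_cong[OF this, of "\<lambda>X. X $$ (0, 0)"] show "x = y" by simp
  qed
  moreover have "?E (x * y) = ?E x * ?E y" for x y
    by (rule eq_matI) (auto simp: scalar_prod_def)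
  ultimately have "star_isomorphism_onto ?E (corner 1 (1\<^sub>m 1))"
    unfolding star_isomorphism_onto_def bij_betw_def
    by (auto simp: mat_star_def mat_scaleC_def intro!: eq_matI)
  then show ?thesis
    by (simp add: corner_isomorphism_def mat_projection_def mat_star_one)
qed

lemma fundamental_group_iff:
  "r \<in> fundamental_group \<tau> \<longleftrightarrow> (\<exists>n p \<phi>. corner_isomorphism n p \<phi> \<and> r = mat_trace \<tau> n p)"
  unfolding fundamental_group_def corner_isomorphism_def by blast

lemma group_pos_reals: "group pos_reals"
proof (rule groupI)
  show "\<exists>y\<in>carrier pos_reals. y \<otimes>\<^bsub>pos_reals\<^esub> x = \<one>\<^bsub>pos_reals\<^esub>" if "x \<in> carrier pos_reals" for x
    using that by (intro bexI[of _ "inverse x"])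
      (auto simp: pos_reals_def less_complex_def complex_eq_iff)
qed (auto simp: pos_reals_def less_complex_def)

theorem theorem3p1:
  fixes \<tau> :: "'a::unital_cstar_algebra \<Rightarrow> complex"
  assumes simple: "simple_cstar TYPE('a)"
    and trace: "tracial_state \<tau>"
    and unique: "\<And>\<sigma> :: 'a \<Rightarrow> complex. tracial_state \<sigma> \<Longrightarrow> \<sigma> = \<tau>"
  shows "subgroup (fundamental_group \<tau>) pos_reals \<and>
    (separable_space (euclidean :: 'a topology) \<longrightarrow> countable (fundamental_group \<tau>))"
proof (intro conjI impI)
  have utc: "unique_trace_corner n p \<phi> \<tau>" if "corner_isomorphism n p \<phi>" for n p \<phi>
    by (rule unique_trace_corner.intro[OF that unique_trace_corner_axioms.intro[OF simple trace unique]])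
  have pos: "0 < r" if "r \<in> fundamental_group \<tau>" for r
    using that unique_trace_corner.trace_pos[OF utc] unfolding fundamental_group_iff by blast
  have mult: "r * s \<in> fundamental_group \<tau>"
    if "r \<in> fundamental_group \<tau>" "s \<in> fundamental_group \<tau>" for r s
  proof -
    obtain n p \<phi> m q \<psi> where p: "corner_isomorphism n p \<phi>" "r = mat_trace \<tau> n p"
      and q: "corner_isomorphism m q \<psi>" "s = mat_trace \<tau> m q"
      using \<open>r \<in> _\<close> \<open>s \<in> _\<close> unfolding fundamental_group_iff by blast
    have "q \<in> carrier_mat m m" using q(1) by (simp add: corner_isomorphism_def mat_projection_def)
    then have "r * s = mat_trace \<tau> (m * n) (corner_isomorphism.amp n \<phi> q)"
      unfolding p(2) q(2) by (rule unique_trace_corner.trace_amp[OF utc[OF p(1)], symmetric])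
    then show ?thesis
      using corner_isomorphism.compose_amp[OF p(1) q(1)] unfolding fundamental_group_iff by blast
  qed
  have inv: "inv\<^bsub>pos_reals\<^esub> r \<in> fundamental_group \<tau>" if r: "r \<in> fundamental_group \<tau>" for r
  proof -
    obtain n p \<phi> where p: "corner_isomorphism n p \<phi>" "r = mat_trace \<tau> n p"
      using r unfolding fundamental_group_iff by blast
    obtain m q \<psi> where "corner_isomorphism m q \<psi>" and rs: "r * mat_trace \<tau> m q = 1"
      using unique_trace_corner.ex_inverse_corner[OF utc[OF p(1)]] p(2) by blast
    then have s: "mat_trace \<tau> m q \<in> fundamental_group \<tau>" unfolding fundamental_group_iff by blast
    have "inv\<^bsub>pos_reals\<^esub> r = mat_trace \<tau> m q"
      using rs pos[OF r] pos[OF s]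
      by (intro group.inv_equality[OF group_pos_reals]) (auto simp: pos_reals_def mult.commute)
    then show ?thesis using s by simp
  qed
  have "mat_trace \<tau> 1 (1\<^sub>m 1) = 1" using trace by (simp add: mat_trace_def tracial_state_def)
  then have "1 \<in> fundamental_group \<tau>"
    using corner_isomorphism_one unfolding fundamental_group_iff by metis
  then show "subgroup (fundamental_group \<tau>) pos_reals"
    using pos mult inv by (auto simp: subgroup_def pos_reals_def)
  \<comment> \<open>The traces of all projections are already countable, whatever their
    corners.\<close>
  show "countable (fundamental_group \<tau>)" if "separable_space (euclidean :: 'a topology)"
    by (rule countable_subset[OF _ countable_projection_traces[OF trace that]])
      (auto simp: fundamental_group_def)
qed

end
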